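(* Let $(S,\|\cdot\|)$ be a complete real random normed module with base $(\Omega,\mathcal F,P)$ such that $P(G(S))>0$. For any $D\in\widetilde{\mathcal F}$ with $D\subset G(S)$ and $P(D)>0$, and any $\epsilon\in L^0_+$ such that $0<\epsilon\le 2$ on $D$, define $$\delta_D(\epsilon)=\bigwedge\left\{I_D-I_D\left\|\tfrac{x+y}{2}\right\|: x,y\in S(1)\text{ with }B_{xy}\supset D\text{ and }I_D\|x-y\|\ge\epsilon I_D\right\},$$ $$\delta^{(1)}_D(\epsilon)=\bigwedge\left\{I_D-I_D\left\|\tfrac{x+y}{2}\right\|: x,y\in S(1)\text{ with }B_{xy}\supset D\text{ and }I_D\|x-y\|=\epsilon I_D\right\},$$ $$\delta^{(2)}_D(\epsilon)=\bigwedge\left\{I_D-I_D\left\|\tfrac{x+y}{2}\right\|: x,y\in U(1)\text{ with }B_{xy}\supset D\text{ and }I_D\|x-y\|\ge\epsilon I_D\right\}.$$ Then $\delta_D(\epsilon)=\delta^{(1)}_D(\epsilon)=\delta^{(2)}_D(\epsilon)$.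
   Context: $(\Omega,\mathcal F,P)$ is a probability space. $L^0(\mathcal F,\mathbb R)$ is the algebra of a.s.-equivalence classes of real random variables, ordered by a.s. inequality; $\bigvee,\bigwedge$ are suprema/infima in the complete lattice of equivalence classes of extended real-valued random variables; $L^0_+=\{\xi\in L^0(\mathcal F,\mathbb R):\xi\ge0\}$. $\widetilde{\mathcal F}$ is the set of equivalence classes of elements of $\mathcal F$ modulo $P$-null sets; inclusion, union, intersection and difference are taken modulo null sets; $I_A$ is the class of the indicator of $A\in\widetilde{\mathcal F}$; $[\xi>0]$ is the class of $\{\omega:\xi^0(\omega)>0\}$ for a representative $\xi^0$ of $\xi$. A relation holds "on $D$" if it holds a.s. on a representative of $D$. A (real) random normed module $(S,\|\cdot\|)$ with base $(\Omega,\mathcal F,P)$ is a left module $S$ over the algebra $L^0(\mathcal F,\mathbb R)$ with a map $\|\cdot\|:S\to L^0_+$ such that $\|\xi x\|=|\xi|\,\|x\|$ for $\xi\in L^0(\mathcal F,\mathbb R)$, $\|x+y\|\le\|x\|+\|y\|$, and $\|x\|=0$ implies $x=\theta$ (the null vector). $S$ carries the metrizable linear topology in which $x_n\to x$ iff $\|x_n-x\|\to0$ in probability; completeness is with respect to it. $H(S)=[\xi>0]$ where $\xi=\bigvee\{\|x\|:x\in S\}$. For $x,y\in S$: $A_x=[\|x\|>0]$, $A_{xy}=A_x\cap A_y$, $B_{xy}=A_{xy}\cap A_{x-y}$. $S(1)=\{x\in S:\|x\|=I_A\text{ for some }A\in\widetilde{\mathcal F}\text{ with }P(A)>0\}$,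 $U(1)=\{x\in S:\|x\|\le1\}$. For $F\in\widetilde{\mathcal F}$, $x,y\in S$ are $L^0$-independent on $F$ if $\xi I_F=\eta I_F=0$ whenever $\xi,\eta\in L^0(\mathcal F,\mathbb R)$ satisfy $\xi I_Fx+\eta I_Fy=\theta$. For $D\in\widetilde{\mathcal F}$ with $D\subset H(S)$, $P(D)>0$, write $\mathrm{Rank}_D(S)\ge2$ if some $x,y\in S$ are $L^0$-independent on $D$, and $\mathrm{Rank}_D(S)<2$ otherwise. If there is some $E\subset H(S)$ with $P(E)>0$ and $\mathrm{Rank}_E(S)\ge2$, then $G(S)$ denotes the unique element of $\widetilde{\mathcal F}$ with $G(S)\subset H(S)$, $P(G(S))>0$, $\mathrm{Rank}_{G(S)}(S)\ge2$, and $\mathrm{Rank}_D(S)<2$ for every $D\subset H(S)\setminus G(S)$ with $P(D)>0$; if there is no such $E$, then $G(S)$ is the class of the empty set, so $P(G(S))=0$. *)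

theory Defs
  imports "HOL-Probability.Probability" "HOL-Algebra.Module" "HOL-Algebra.Complete_Lattice"
begin

section \<open>Classes of random variables and of events\<close>

text \<open>An element of a quotient modulo almost sure equality is the set of all its (measurable)
  representatives. \<open>rep\<close> picks one of them. Everything below depends on the chosen
  representative only up to a null set.\<close>

definition rep :: "'a set \<Rightarrow> 'a" where
  "rep X = (SOME f. f \<in> X)"

definition rv_class :: "'w measure \<Rightarrow> ('w \<Rightarrow> 'b::topological_space) \<Rightarrow> ('w \<Rightarrow> 'b) set" where
  "rv_class M f = {g \<in> borel_measurable M. AE \<omega> in M. g \<omega> = f \<omega>}"

definition RV :: "'w measure \<Rightarrow> ('w \<Rightarrow> 'b::topological_space) set set" where
  "RV M = rv_class M ` borel_measurable M"

definition rv_le :: "'w measure \<Rightarrow> ('w \<Rightarrow> 'b::ord) set \<Rightarrow> ('w \<Rightarrow> 'b) set \<Rightarrow> bool" where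
  "rv_le M X Y \<longleftrightarrow> (AE \<omega> in M. rep X \<omega> \<le> rep Y \<omega>)"

definition ev_class :: "'w measure \<Rightarrow> 'w set \<Rightarrow> 'w set set" where
  "ev_class M A = {B \<in> sets M. AE \<omega> in M. \<omega> \<in> B \<longleftrightarrow> \<omega> \<in> A}"

definition Ev :: "'w measure \<Rightarrow> 'w set set set" where
  "Ev M = ev_class M ` sets M"

definition ev_prob :: "'w measure \<Rightarrow> 'w set set \<Rightarrow> real" where
  "ev_prob M A = measure M (rep A)"

definition ev_subset :: "'w measure \<Rightarrow> 'w set set \<Rightarrow> 'w set set \<Rightarrow> bool" where
  "ev_subset M A B \<longleftrightarrow> (AE \<omega> in M. \<omega> \<in> rep A \<longrightarrow> \<omega> \<in> rep B)"

definition ev_Int :: "'w measure \<Rightarrow> 'w set set \<Rightarrow> 'w set set \<Rightarrow> 'w set set" where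
  "ev_Int M A B = ev_class M (rep A \<inter> rep B)"

definition ev_Diff :: "'w measure \<Rightarrow> 'w set set \<Rightarrow> 'w set set \<Rightarrow> 'w set set" where
  "ev_Diff M A B = ev_class M (rep A - rep B)"

text \<open>\<open>[\<xi> > 0]\<close>, for real or extended real classes.\<close>

definition ev_pos :: "'w measure \<Rightarrow> ('w \<Rightarrow> 'b::{ord,zero}) set \<Rightarrow> 'w set set" where
  "ev_pos M X = ev_class M {\<omega> \<in> space M. rep X \<omega> > 0}"


section \<open>The algebra \<open>L\<^sup>0\<close> and the lattice of extended real classes\<close>

definition L0 :: "'w measure \<Rightarrow> ('w \<Rightarrow> real) set ring" where
  "L0 M = \<lparr>carrier = RV M,
     mult = (\<lambda>X Y. rv_class M (\<lambda>\<omega>. rep X \<omega> * rep Y \<omega>)),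
     one = rv_class M (\<lambda>_. 1),
     zero = rv_class M (\<lambda>_. 0),
     add = (\<lambda>X Y. rv_class M (\<lambda>\<omega>. rep X \<omega> + rep Y \<omega>))\<rparr>"

definition L0_pos :: "'w measure \<Rightarrow> ('w \<Rightarrow> real) set set" where
  "L0_pos M = {X \<in> carrier (L0 M). rv_le M \<zero>\<^bsub>L0 M\<^esub> X}"

definition L0_abs :: "'w measure \<Rightarrow> ('w \<Rightarrow> real) set \<Rightarrow> ('w \<Rightarrow> real) set" where
  "L0_abs M X = rv_class M (\<lambda>\<omega>. \<bar>rep X \<omega>\<bar>)"

definition L0_ind :: "'w measure \<Rightarrow> 'w set set \<Rightarrow> ('w \<Rightarrow> real) set" where
  "L0_ind M A = rv_class M (indicator (rep A))"

definition L0_ext :: "'w measure \<Rightarrow> ('w \<Rightarrow> real) set \<Rightarrow> ('w \<Rightarrow> ereal) set" where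
  "L0_ext M X = rv_class M (\<lambda>\<omega>. ereal (rep X \<omega>))"

lemma rep_rv_class:
  assumes "f \<in> borel_measurable M"
  shows "rep (rv_class M f) \<in> borel_measurable M" "AE \<omega> in M. rep (rv_class M f) \<omega> = f \<omega>"
proof -
  have "f \<in> rv_class M f" using assms by (simp add: rv_class_def)
  then have "rep (rv_class M f) \<in> rv_class M f" unfolding rep_def by (rule someI[of "\<lambda>h. h \<in> rv_class M f"])
  then show "rep (rv_class M f) \<in> borel_measurable M" "AE \<omega> in M. rep (rv_class M f) \<omega> = f \<omega>"
    by (auto simp: rv_class_def)
qed

lemma rv_class_cong:
  assumes "AE \<omega> in M. f \<omega> = g \<omega>"
  shows "rv_class M f = rv_class M g"
  using assms unfolding rv_class_def by (auto elim!: eventually_elim2)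

lemma rep_RV:
  assumes "X \<in> RV M"
  shows "rep X \<in> borel_measurable M" "rv_class M (rep X) = X"
proof -
  obtain f where f: "f \<in> borel_measurable M" "X = rv_class M f" using assms by (auto simp: RV_def)
  show "rep X \<in> borel_measurable M" using rep_rv_class(1)[OF f(1)] f(2) by simp
  show "rv_class M (rep X) = X" using rv_class_cong[OF rep_rv_class(2)[OF f(1)]] f(2) by simp
qed

lemma rv_class_add:
  fixes f g :: "'w \<Rightarrow> real"
  assumes [measurable]: "f \<in> borel_measurable M" "g \<in> borel_measurable M"
  shows "rv_class M f \<oplus>\<^bsub>L0 M\<^esub> rv_class M g = rv_class M (\<lambda>\<omega>. f \<omega> + g \<omega>)"
  using rep_rv_class(2)[OF assms(1)] rep_rv_class(2)[OF assms(2)]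
  by (auto simp: L0_def intro!: rv_class_cong elim: eventually_elim2)

lemma rv_class_mult:
  fixes f g :: "'w \<Rightarrow> real"
  assumes [measurable]: "f \<in> borel_measurable M" "g \<in> borel_measurable M"
  shows "rv_class M f \<otimes>\<^bsub>L0 M\<^esub> rv_class M g = rv_class M (\<lambda>\<omega>. f \<omega> * g \<omega>)"
  using rep_rv_class(2)[OF assms(1)] rep_rv_class(2)[OF assms(2)]
  by (auto simp: L0_def intro!: rv_class_cong elim: eventually_elim2)

lemma cring_L0: "cring (L0 M)"
proof -
  have c: "carrier (L0 M) = rv_class M ` borel_measurable M"
    and z: "\<zero>\<^bsub>L0 M\<^esub> = rv_class M (\<lambda>_. 0)" and o: "\<one>\<^bsub>L0 M\<^esub> = rv_class M (\<lambda>_. 1)"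
    by (auto simp: L0_def RV_def)
  show ?thesis
  proof (intro cringI abelian_groupI comm_monoidI)
    fix x assume "x \<in> carrier (L0 M)"
    then obtain f where f: "f \<in> borel_measurable M" "x = rv_class M f" by (auto simp: c)
    have "rv_class M (\<lambda>\<omega>. - f \<omega>) \<oplus>\<^bsub>L0 M\<^esub> x = \<zero>\<^bsub>L0 M\<^esub>"
      using f by (simp add: rv_class_add z)
    then show "\<exists>y\<in>carrier (L0 M). y \<oplus>\<^bsub>L0 M\<^esub> x = \<zero>\<^bsub>L0 M\<^esub>" using f by (auto simp: c)
  qed (auto simp: c z o rv_class_add rv_class_mult algebra_simps)
qed

text \<open>\<open>\<Squnion>\<^bsub>L0bar M\<^esub>\<close> and \<open>\<Sqinter>\<^bsub>L0bar M\<^esub>\<close> are the essential supremum and infimum of a family.\<close>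

definition L0bar :: "'w measure \<Rightarrow> ('w \<Rightarrow> ereal) set gorder" where
  "L0bar M = \<lparr>carrier = RV M, eq = (=), le = rv_le M\<rparr>"

lemma partial_order_L0bar: "partial_order (L0bar M)"
proof (unfold_locales, goal_cases)
  case (5 x y)
  then have *: "x \<in> RV M" "y \<in> RV M" and "AE w in M. rep x w = rep y w"
    by (auto simp: L0bar_def rv_le_def elim!: eventually_elim2)
  then have "x = y" using rep_RV(2)[OF *(1)] rep_RV(2)[OF *(2)] rv_class_cong[of "rep x" "rep y" M] by metis
  then show ?case by (simp add: L0bar_def)
next
  case (6 x y z) then show ?case by (auto simp: L0bar_def rv_le_def elim!: eventually_elim2)
qed (auto simp: L0bar_def rv_le_def)


section \<open>Random normed modules\<close>

record ('a, 'b) rn_module = "('a, 'b) module" +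
  rnorm :: "'b \<Rightarrow> 'a"  (\<open>\<parallel>_\<parallel>\<index>\<close>)

text \<open>As for every module in HOL-Algebra, the ring multiplication and unit carried by the record
  \<open>S\<close> are not used.\<close>

locale random_normed_module =
  prob_space M + Module.module "L0 M" S
  for M :: "'w measure" and S :: "(('w \<Rightarrow> real) set, 's, 'm) rn_module_scheme" (structure) +
  assumes rnorm_closed: "x \<in> carrier S \<Longrightarrow> \<parallel>x\<parallel> \<in> L0_pos M"
    and rnorm_smult:
      "\<lbrakk>\<xi> \<in> carrier (L0 M); x \<in> carrier S\<rbrakk> \<Longrightarrow> \<parallel>\<xi> \<odot> x\<parallel> = L0_abs M \<xi> \<otimes>\<^bsub>L0 M\<^esub> \<parallel>x\<parallel>"
    and rnorm_triangle:
      "\<lbrakk>x \<in> carrier S; y \<in> carrier S\<rbrakk> \<Longrightarrow> rv_le M \<parallel>x \<oplus> y\<parallel> (\<parallel>x\<parallel> \<oplus>\<^bsub>L0 M\<^esub> \<parallel>y\<parallel>)"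
    and rnorm_eq_zero: "\<lbrakk>x \<in> carrier S; \<parallel>x\<parallel> = \<zero>\<^bsub>L0 M\<^esub>\<rbrakk> \<Longrightarrow> x = \<zero>"

text \<open>Completeness for the topology of convergence in probability. This linear topology is
  metrizable, so sequences suffice, and a sequence is Cauchy iff \<open>\<parallel>x m - x n\<parallel>\<close> tends to \<open>0\<close> in
  probability as \<open>m, n\<close> tend to infinity.\<close>

definition prob_gt :: "'w measure \<Rightarrow> ('w \<Rightarrow> real) set \<Rightarrow> real \<Rightarrow> real" where
  "prob_gt M X e = measure M {\<omega> \<in> space M. rep X \<omega> > e}"

definition rn_tendsto ::
  "'w measure \<Rightarrow> (('w \<Rightarrow> real) set, 's, 'm) rn_module_scheme \<Rightarrow> (nat \<Rightarrow> 's) \<Rightarrow> 's \<Rightarrow> bool" where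
  "rn_tendsto M S x l \<longleftrightarrow> (\<forall>e>0. (\<lambda>n. prob_gt M \<parallel>x n \<ominus>\<^bsub>S\<^esub> l\<parallel>\<^bsub>S\<^esub> e) \<longlonglongrightarrow> 0)"

definition rn_Cauchy ::
  "'w measure \<Rightarrow> (('w \<Rightarrow> real) set, 's, 'm) rn_module_scheme \<Rightarrow> (nat \<Rightarrow> 's) \<Rightarrow> bool" where
  "rn_Cauchy M S x \<longleftrightarrow>
    (\<forall>e>0. \<forall>r>0. \<exists>N. \<forall>m\<ge>N. \<forall>n\<ge>N. prob_gt M \<parallel>x m \<ominus>\<^bsub>S\<^esub> x n\<parallel>\<^bsub>S\<^esub> e < r)"

definition rn_complete ::
  "'w measure \<Rightarrow> (('w \<Rightarrow> real) set, 's, 'm) rn_module_scheme \<Rightarrow> bool" where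
  "rn_complete M S \<longleftrightarrow>
    (\<forall>x. range x \<subseteq> carrier S \<and> rn_Cauchy M S x \<longrightarrow> (\<exists>l\<in>carrier S. rn_tendsto M S x l))"


section \<open>Supports, unit sphere, unit ball\<close>

definition H_of :: "'w measure \<Rightarrow> (('w \<Rightarrow> real) set, 's, 'm) rn_module_scheme \<Rightarrow> 'w set set" where
  "H_of M S = ev_pos M (\<Squnion>\<^bsub>L0bar M\<^esub> {L0_ext M \<parallel>x\<parallel>\<^bsub>S\<^esub> |x. x \<in> carrier S})"

definition A_of ::
  "'w measure \<Rightarrow> (('w \<Rightarrow> real) set, 's, 'm) rn_module_scheme \<Rightarrow> 's \<Rightarrow> 'w set set" where
  "A_of M S x = ev_pos M \<parallel>x\<parallel>\<^bsub>S\<^esub>"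

definition B_of ::
  "'w measure \<Rightarrow> (('w \<Rightarrow> real) set, 's, 'm) rn_module_scheme \<Rightarrow> 's \<Rightarrow> 's \<Rightarrow> 'w set set" where
  "B_of M S x y = ev_Int M (ev_Int M (A_of M S x) (A_of M S y)) (A_of M S (x \<ominus>\<^bsub>S\<^esub> y))"

definition S1 :: "'w measure \<Rightarrow> (('w \<Rightarrow> real) set, 's, 'm) rn_module_scheme \<Rightarrow> 's set" where
  "S1 M S = {x \<in> carrier S. \<exists>A\<in>Ev M. ev_prob M A > 0 \<and> \<parallel>x\<parallel>\<^bsub>S\<^esub> = L0_ind M A}"

definition U1 :: "'w measure \<Rightarrow> (('w \<Rightarrow> real) set, 's, 'm) rn_module_scheme \<Rightarrow> 's set" where
  "U1 M S = {x \<in> carrier S. rv_le M \<parallel>x\<parallel>\<^bsub>S\<^esub> \<one>\<^bsub>L0 M\<^esub>}"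


section \<open>Rank\<close>

definition L0_indep_on ::
  "'w measure \<Rightarrow> (('w \<Rightarrow> real) set, 's, 'm) rn_module_scheme \<Rightarrow> 'w set set \<Rightarrow> 's \<Rightarrow> 's \<Rightarrow> bool" where
  "L0_indep_on M S F x y \<longleftrightarrow>
    (\<forall>\<xi>\<in>carrier (L0 M). \<forall>\<eta>\<in>carrier (L0 M).
      ((\<xi> \<otimes>\<^bsub>L0 M\<^esub> L0_ind M F) \<odot>\<^bsub>S\<^esub> x) \<oplus>\<^bsub>S\<^esub> ((\<eta> \<otimes>\<^bsub>L0 M\<^esub> L0_ind M F) \<odot>\<^bsub>S\<^esub> y) = \<zero>\<^bsub>S\<^esub> \<longrightarrow>
      \<xi> \<otimes>\<^bsub>L0 M\<^esub> L0_ind M F = \<zero>\<^bsub>L0 M\<^esub> \<and> \<eta> \<otimes>\<^bsub>L0 M\<^esub> L0_ind M F = \<zero>\<^bsub>L0 M\<^esub>)"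

definition rank_ge2 ::
  "'w measure \<Rightarrow> (('w \<Rightarrow> real) set, 's, 'm) rn_module_scheme \<Rightarrow> 'w set set \<Rightarrow> bool" where
  "rank_ge2 M S D \<longleftrightarrow> (\<exists>x\<in>carrier S. \<exists>y\<in>carrier S. L0_indep_on M S D x y)"

definition G_of :: "'w measure \<Rightarrow> (('w \<Rightarrow> real) set, 's, 'm) rn_module_scheme \<Rightarrow> 'w set set" where
  "G_of M S =
    (if \<exists>E\<in>Ev M. ev_subset M E (H_of M S) \<and> ev_prob M E > 0 \<and> rank_ge2 M S E
     then THE G. G \<in> Ev M \<and> ev_subset M G (H_of M S) \<and> ev_prob M G > 0 \<and> rank_ge2 M S G \<and>
            (\<forall>D\<in>Ev M. ev_subset M D (ev_Diff M (H_of M S) G) \<and> ev_prob M D > 0 \<longrightarrow>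
              \<not> rank_ge2 M S D)
     else ev_class M {})"


section \<open>Moduli of convexity\<close>

text \<open>\<open>I\<^sub>D - I\<^sub>D \<parallel>(x + y) / 2\<parallel>\<close>, as an extended real class.\<close>

definition convexity_gap ::
  "'w measure \<Rightarrow> (('w \<Rightarrow> real) set, 's, 'm) rn_module_scheme \<Rightarrow> 'w set set \<Rightarrow> 's \<Rightarrow> 's
    \<Rightarrow> ('w \<Rightarrow> ereal) set" where
  "convexity_gap M S D x y = L0_ext M
    (L0_ind M D \<ominus>\<^bsub>L0 M\<^esub>
      (L0_ind M D \<otimes>\<^bsub>L0 M\<^esub> \<parallel>rv_class M (\<lambda>_. 1 / 2) \<odot>\<^bsub>S\<^esub> (x \<oplus>\<^bsub>S\<^esub> y)\<parallel>\<^bsub>S\<^esub>))"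

definition delta ::
  "'w measure \<Rightarrow> (('w \<Rightarrow> real) set, 's, 'm) rn_module_scheme \<Rightarrow> 'w set set \<Rightarrow> ('w \<Rightarrow> real) set
    \<Rightarrow> ('w \<Rightarrow> ereal) set" where
  "delta M S D \<epsilon> = \<Sqinter>\<^bsub>L0bar M\<^esub> {convexity_gap M S D x y |x y.
     x \<in> S1 M S \<and> y \<in> S1 M S \<and> ev_subset M D (B_of M S x y) \<and>
     rv_le M (\<epsilon> \<otimes>\<^bsub>L0 M\<^esub> L0_ind M D) (L0_ind M D \<otimes>\<^bsub>L0 M\<^esub> \<parallel>x \<ominus>\<^bsub>S\<^esub> y\<parallel>\<^bsub>S\<^esub>)}"

definition delta1 ::
  "'w measure \<Rightarrow> (('w \<Rightarrow> real) set, 's, 'm) rn_module_scheme \<Rightarrow> 'w set set \<Rightarrow> ('w \<Rightarrow> real) set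
    \<Rightarrow> ('w \<Rightarrow> ereal) set" where
  "delta1 M S D \<epsilon> = \<Sqinter>\<^bsub>L0bar M\<^esub> {convexity_gap M S D x y |x y.
     x \<in> S1 M S \<and> y \<in> S1 M S \<and> ev_subset M D (B_of M S x y) \<and>
     L0_ind M D \<otimes>\<^bsub>L0 M\<^esub> \<parallel>x \<ominus>\<^bsub>S\<^esub> y\<parallel>\<^bsub>S\<^esub> = \<epsilon> \<otimes>\<^bsub>L0 M\<^esub> L0_ind M D}"

definition delta2 ::
  "'w measure \<Rightarrow> (('w \<Rightarrow> real) set, 's, 'm) rn_module_scheme \<Rightarrow> 'w set set \<Rightarrow> ('w \<Rightarrow> real) set
    \<Rightarrow> ('w \<Rightarrow> ereal) set" where
  "delta2 M S D \<epsilon> = \<Sqinter>\<^bsub>L0bar M\<^esub> {convexity_gap M S D x y |x y.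
     x \<in> U1 M S \<and> y \<in> U1 M S \<and> ev_subset M D (B_of M S x y) \<and>
     rv_le M (\<epsilon> \<otimes>\<^bsub>L0 M\<^esub> L0_ind M D) (L0_ind M D \<otimes>\<^bsub>L0 M\<^esub> \<parallel>x \<ominus>\<^bsub>S\<^esub> y\<parallel>\<^bsub>S\<^esub>)}"

end

theory Submission
  imports Defs
begin

text \<open>
  A pair that competes in \<open>\<delta>\<^sup>(\<^sup>1\<^sup>)\<close> competes in \<open>\<delta>\<close>, and a pair that competes in \<open>\<delta>\<close> competes in
  \<open>\<delta>\<^sup>(\<^sup>2\<^sup>)\<close>. An infimum is determined by the lower bounds of its family, so it suffices that
  every gap of the largest family dominates a gap of the smallest one: for \<open>x\<close>, \<open>y\<close> in the unit
  ball with \<open>\<parallel>x - y\<parallel> \<ge> \<epsilon>\<close> on \<open>D\<close> there are \<open>X\<close>, \<open>Y\<close> of norm \<open>1\<close> on \<open>D\<close> with \<open>\<parallel>X - Y\<parallel> = \<epsilon>\<close> and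
  \<open>\<parallel>X + Y\<parallel> \<ge> \<parallel>x + y\<parallel>\<close> there (\<open>ball_pair_dominated_by_sphere_pair\<close>). Put \<open>p = \<parallel>x - y\<parallel>\<close> and
  \<open>q = \<parallel>x + y\<parallel>\<close>; two regions of \<open>D\<close> are treated separately and the results are pasted.

  Where \<open>q \<le> 2 - \<epsilon>\<close>, every pair of unit vectors at distance \<open>\<epsilon>\<close> will do, because
  \<open>\<parallel>X + Y\<parallel> \<ge> 2 \<parallel>X\<parallel> - \<parallel>X - Y\<parallel> = 2 - \<epsilon>\<close>. Such a pair exists because the rank is at least two: some
  path leads from a unit vector \<open>X\<close> to \<open>-X\<close> without meeting the origin, and on the way the
  normalised point passes through the distance \<open>\<epsilon>\<close> from \<open>X\<close> (\<open>unit_pair_at_distance\<close>). This region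
  contains every point of \<open>D\<close> where \<open>x\<close> and \<open>y\<close> are linearly dependent, since there \<open>p + q \<le> 2\<close>.

  Where \<open>q > 2 - \<epsilon>\<close>, we have \<open>p + q > 2\<close>. The direction \<open>v = p (x + y) - q (x - y)\<close> has the property
  that moving \<open>y\<close> to \<open>y + t v\<close> with \<open>t \<ge> 0\<close> decreases neither \<open>\<parallel>x + y\<parallel>\<close> nor \<open>\<parallel>x - y\<parallel>\<close>, by the
  triangle inequality alone, and \<open>p + q > 2\<close> forces \<open>v \<noteq> 0\<close>. So \<open>y\<close>, and then \<open>x\<close> by symmetry, can be
  pushed to the unit sphere (\<open>push_to_sphere\<close>). Finally \<open>y\<close> slides along the arc towards \<open>x\<close> until the
  distance is exactly \<open>\<epsilon>\<close>, and this does not decrease \<open>\<parallel>x + y\<parallel>\<close> (\<open>slide_along_arc\<close>).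

  Two points are particular to the random setting. First, each of these motions stops at a random
  time that has to be measurable. The functionals involved are Lipschitz in the random parameter,
  uniformly over \<open>D\<close>, and then a monotone iteration produces a measurable root
  (\<open>measurable_intermediate_value\<close>). Secondly, \<open>G(S)\<close> is given by a definite description. That it
  denotes a set of rank at least two needs an exhaustion argument, in which countably many
  independent pairs on disjoint sets are pasted into one; the pasted vector is the limit of a Cauchy
  sequence, and here completeness enters (\<open>countable_pasting\<close>, \<open>two_dimensional_on_G\<close>).
\<close>

section \<open>Measurable roots and exhaustion\<close>

text \<open>The iteration \<open>t \<mapsto> t + (e - F t) / C\<close> from \<open>0\<close> never overshoots: a step changes \<open>F\<close> by at most
  the deficit \<open>e - F t\<close>, so \<open>F t \<le> e\<close> persists, and \<open>e - F t \<le> F T - F t \<le> C (T - t)\<close> keeps the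
  next iterate below \<open>T\<close>. So the iterates increase to a limit, which is a root because the steps
  tend to zero, and it is measurable since every iterate is.\<close>

lemma measurable_intermediate_value:
  fixes F :: "('w \<Rightarrow> real) \<Rightarrow> 'w \<Rightarrow> real"
  assumes F[measurable]: "\<And>f. f \<in> borel_measurable M \<Longrightarrow> F f \<in> borel_measurable M"
    and e[measurable]: "e \<in> borel_measurable M"
    and C: "C > 0" and T: "0 \<le> T"
    and lip: "\<And>f g. \<lbrakk>f \<in> borel_measurable M; g \<in> borel_measurable M\<rbrakk> \<Longrightarrow>
      AE \<omega> in M. \<omega> \<in> D \<longrightarrow> \<bar>F f \<omega> - F g \<omega>\<bar> \<le> C * \<bar>f \<omega> - g \<omega>\<bar>"
    and F0: "AE \<omega> in M. \<omega> \<in> D \<longrightarrow> F (\<lambda>_. 0) \<omega> \<le> e \<omega>"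
    and FT: "AE \<omega> in M. \<omega> \<in> D \<longrightarrow> e \<omega> \<le> F (\<lambda>_. T) \<omega>"
  obtains t where "t \<in> borel_measurable M" "\<And>\<omega>. 0 \<le> t \<omega>" "\<And>\<omega>. t \<omega> \<le> T"
    "AE \<omega> in M. \<omega> \<in> D \<longrightarrow> F t \<omega> = e \<omega>"
proof -
  \<comment> \<open>The truncation to \<open>[0, T]\<close> is inactive almost everywhere on \<open>D\<close>. It keeps the iterates
    bounded, and hence their supremum well behaved, elsewhere.\<close>
  define u where "u n = ((\<lambda>s \<omega>. max 0 (min T (s \<omega> + (e \<omega> - F s \<omega>) / C))) ^^ n) (\<lambda>_. 0)" for n
  have u0: "u 0 = (\<lambda>_. 0)"
    and uS: "u (Suc n) = (\<lambda>\<omega>. max 0 (min T (u n \<omega> + (e \<omega> - F (u n) \<omega>) / C)))" for n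
    by (simp_all add: u_def)
  have um[measurable]: "u n \<in> borel_measurable M" for n
    by (induction n) (simp_all add: u0 uS)
  have u_ge: "0 \<le> u n \<omega>" and u_le: "u n \<omega> \<le> T" for n \<omega>
    using T by (cases n; simp add: u0 uS)+
  have bdd: "bdd_above (range (\<lambda>n. u n \<omega>))" for \<omega>
    using u_le by (auto simp: bdd_above_def)
  define t where "t = (\<lambda>\<omega>. SUP n. u n \<omega>)"
  have tm[measurable]: "t \<in> borel_measurable M"
    unfolding t_def using bdd by measurable
  have t_le: "t \<omega> \<le> T" for \<omega>
    unfolding t_def using u_le by (intro cSUP_least) auto
  have t_ge: "0 \<le> t \<omega>" for \<omega>
    unfolding t_def using u_ge bdd by (meson cSUP_upper2 UNIV_I)
  have "AE \<omega> in M. \<forall>n. \<omega> \<in> D \<longrightarrow> \<bar>F (u n) \<omega> - F t \<omega>\<bar> \<le> C * \<bar>u n \<omega> - t \<omega>\<bar>"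
    unfolding AE_all_countable by (intro allI lip) auto
  moreover have "AE \<omega> in M. \<forall>n. \<omega> \<in> D \<longrightarrow> \<bar>F (u (Suc n)) \<omega> - F (u n) \<omega>\<bar> \<le> C * \<bar>u (Suc n) \<omega> - u n \<omega>\<bar>"
    unfolding AE_all_countable by (intro allI lip) auto
  moreover have "AE \<omega> in M. \<forall>n. \<omega> \<in> D \<longrightarrow> \<bar>F (\<lambda>_. T) \<omega> - F (u n) \<omega>\<bar> \<le> C * \<bar>T - u n \<omega>\<bar>"
    unfolding AE_all_countable by (intro allI lip) auto
  ultimately have "AE \<omega> in M. \<omega> \<in> D \<longrightarrow> F t \<omega> = e \<omega>"
    using F0 FT
  proof eventually_elim
    case (elim \<omega>)
    show ?case
    proof
      assume D: "\<omega> \<in> D"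
      have step: "u (Suc n) \<omega> = u n \<omega> + (e \<omega> - F (u n) \<omega>) / C" if "F (u n) \<omega> \<le> e \<omega>" for n
      proof -
        have "e \<omega> - F (u n) \<omega> \<le> C * (T - u n \<omega>)"
          using elim D u_le[of n \<omega>] by (smt (verit))
        then have "(e \<omega> - F (u n) \<omega>) / C \<le> T - u n \<omega>"
          using C by (simp add: pos_divide_le_eq mult.commute)
        moreover have "0 \<le> (e \<omega> - F (u n) \<omega>) / C" using that C by simp
        ultimately show ?thesis using u_ge[of n \<omega>] by (simp add: uS)
      qed
      have le: "F (u n) \<omega> \<le> e \<omega>" for n
      proof (induction n)
        case 0 then show ?case using elim D by (simp add: u0)
      next
        case (Suc n)
        have "u (Suc n) \<omega> - u n \<omega> = (e \<omega> - F (u n) \<omega>) / C" using step[OF Suc] by simp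
        then have "C * \<bar>u (Suc n) \<omega> - u n \<omega>\<bar> = e \<omega> - F (u n) \<omega>" using C Suc by (simp add: abs_mult)
        then show ?case using elim(2) D by (smt (verit))
      qed
      have "u n \<omega> \<le> u (Suc n) \<omega>" for n
        using step[OF le] le[of n] C by simp
      then have lim: "(\<lambda>n. u n \<omega>) \<longlonglongrightarrow> t \<omega>"
        unfolding t_def by (intro LIMSEQ_incseq_SUP bdd incseq_SucI)
      have "(\<lambda>n. C * (u (Suc n) \<omega> - u n \<omega>)) \<longlonglongrightarrow> C * (t \<omega> - t \<omega>)"
        by (intro tendsto_intros lim LIMSEQ_Suc)
      then have "(\<lambda>n. e \<omega> - F (u n) \<omega>) \<longlonglongrightarrow> 0"
        using step[OF le] C by simp
      moreover have "(\<lambda>n. F (u n) \<omega> - F t \<omega>) \<longlonglongrightarrow> 0"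
      proof (rule Lim_null_comparison)
        have "(\<lambda>n. C * \<bar>u n \<omega> - t \<omega>\<bar>) \<longlonglongrightarrow> C * \<bar>t \<omega> - t \<omega>\<bar>"
          by (intro tendsto_intros lim)
        then show "(\<lambda>n. C * \<bar>u n \<omega> - t \<omega>\<bar>) \<longlonglongrightarrow> 0" by simp
      qed (use elim(1) D in auto)
      ultimately have "(\<lambda>n. (e \<omega> - F (u n) \<omega>) + (F (u n) \<omega> - F t \<omega>)) \<longlonglongrightarrow> 0 + 0"
        by (rule tendsto_add)
      then show "F t \<omega> = e \<omega>" by (simp add: LIMSEQ_const_iff)
    qed
  qed
  then show thesis using that tm t_ge t_le by blast
qed

text \<open>A countable union of members whose probabilities approach the supremum attains it, and then
  another member cannot exceed the union by more than a null set.\<close>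

lemma (in prob_space) exhaustion:
  assumes C: "C \<subseteq> sets M" and ne: "C \<noteq> {}"
    and Un: "\<And>A :: nat \<Rightarrow> 'a set. range A \<subseteq> C \<Longrightarrow> (\<Union>n. A n) \<in> C"
  obtains E where "E \<in> C" "\<And>F. F \<in> C \<Longrightarrow> AE \<omega> in M. \<omega> \<in> F \<longrightarrow> \<omega> \<in> E"
proof -
  define s where "s = Sup (prob ` C)"
  have bdd: "bdd_above (prob ` C)" by (auto simp: bdd_above_def intro: exI[of _ 1])
  have "\<exists>A\<in>C. s - 1 / real (Suc n) < prob A" for n
  proof -
    have "s - 1 / real (Suc n) < Sup (prob ` C)" by (simp add: s_def)
    then show ?thesis using ne less_cSup_iff[OF _ bdd] by auto
  qed
  then obtain A where A: "\<And>n. A n \<in> C" "\<And>n. s - 1 / real (Suc n) < prob (A n)" by metis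
  define E where "E = (\<Union>n. A n)"
  have E: "E \<in> C" unfolding E_def using A by (intro Un) auto
  have sE: "s \<le> prob E"
  proof (rule LIMSEQ_le_const2)
    show "(\<lambda>n. s - 1 / real (Suc n)) \<longlonglongrightarrow> s"
      using tendsto_diff[OF tendsto_const[of s] LIMSEQ_inverse_real_of_nat] by (simp add: inverse_eq_divide)
    have "prob (A n) \<le> prob E" for n
      using A E C by (intro finite_measure_mono) (auto simp: E_def)
    then show "\<exists>N. \<forall>n\<ge>N. s - 1 / real (Suc n) \<le> prob E" using A(2) by (meson less_imp_le order_trans)
  qed
  have "AE \<omega> in M. \<omega> \<in> F \<longrightarrow> \<omega> \<in> E" if F: "F \<in> C" for F
  proof -
    have [measurable]: "E \<in> sets M" "F \<in> sets M" using E F C by auto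
    have "(\<Union>n::nat. if n = 0 then E else F) \<in> C" using E F by (intro Un) auto
    also have "(\<Union>n::nat. if n = 0 then E else F) = E \<union> (F - E)" by (auto split: if_splits)
    finally have "prob (E \<union> (F - E)) \<le> s" unfolding s_def by (intro cSup_upper bdd) auto
    moreover have "prob (E \<union> (F - E)) = prob E + prob (F - E)"
      by (rule finite_measure_Union) auto
    ultimately have "prob (F - E) = 0" using sE by (smt (verit) measure_nonneg)
    then have "AE \<omega> in M. \<omega> \<notin> F - E" by (subst prob_eq_0[symmetric]) auto
    then show ?thesis by eventually_elim auto
  qed
  then show thesis using that E by blast
qed

section \<open>Representatives of events\<close>

lemma rep_ev_class:
  assumes "A \<in> sets M"
  shows "rep (ev_class M A) \<in> sets M" "AE \<omega> in M. \<omega> \<in> rep (ev_class M A) \<longleftrightarrow> \<omega> \<in> A"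
proof -
  have "A \<in> ev_class M A" using assms by (simp add: ev_class_def)
  then have "rep (ev_class M A) \<in> ev_class M A" unfolding rep_def by (rule someI[of "\<lambda>h. h \<in> ev_class M A"])
  then show "rep (ev_class M A) \<in> sets M" "AE \<omega> in M. \<omega> \<in> rep (ev_class M A) \<longleftrightarrow> \<omega> \<in> A"
    by (auto simp: ev_class_def)
qed

lemma ev_class_cong:
  assumes "AE \<omega> in M. \<omega> \<in> A \<longleftrightarrow> \<omega> \<in> B"
  shows "ev_class M A = ev_class M B"
  using assms unfolding ev_class_def by (auto elim!: eventually_elim2)

lemma rep_Ev:
  assumes "A \<in> Ev M"
  shows "rep A \<in> sets M" "ev_class M (rep A) = A"
proof -
  obtain B where B: "B \<in> sets M" "A = ev_class M B" using assms by (auto simp: Ev_def)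
  show "rep A \<in> sets M" using rep_ev_class(1)[OF B(1)] B(2) by simp
  show "ev_class M (rep A) = A" using ev_class_cong[OF rep_ev_class(2)[OF B(1)]] B(2) by simp
qed

lemma ev_class_in_Ev: "A \<in> sets M \<Longrightarrow> ev_class M A \<in> Ev M"
  by (simp add: Ev_def)

lemma (in prob_space) ev_prob_pos_iff:
  assumes "A \<in> Ev M"
  shows "ev_prob M A > 0 \<longleftrightarrow> \<not> (AE \<omega> in M. \<omega> \<notin> rep A)"
  using prob_eq_0[OF rep_Ev(1)[OF assms]] by (auto simp: ev_prob_def zero_less_measure_iff)

lemma rv_le_class_iff:
  fixes f g :: "'w \<Rightarrow> 'b::{ord, topological_space}"
  assumes "f \<in> borel_measurable M" "g \<in> borel_measurable M"
  shows "rv_le M (rv_class M f) (rv_class M g) \<longleftrightarrow> (AE \<omega> in M. f \<omega> \<le> g \<omega>)"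
  unfolding rv_le_def
  by (rule eventually_subst) (use rep_rv_class(2)[OF assms(1)] rep_rv_class(2)[OF assms(2)] in eventually_elim, simp)

section \<open>Random linear combinations of two vectors\<close>

context random_normed_module
begin

definition nrm :: "'s \<Rightarrow> 'w \<Rightarrow> real" where
  "nrm x = rep \<parallel>x\<parallel>"

text \<open>The geometry below takes place in the plane spanned by two vectors. With random coordinates \<open>f\<close>,
  \<open>g\<close>, identities between vectors of that plane become pointwise identities between real functions.\<close>

definition comb :: "('w \<Rightarrow> real) \<Rightarrow> 's \<Rightarrow> ('w \<Rightarrow> real) \<Rightarrow> 's \<Rightarrow> 's" where
  "comb f x g y = rv_class M f \<odot> x \<oplus> rv_class M g \<odot> y"

lemma rnorm_in_RV: "x \<in> carrier S \<Longrightarrow> \<parallel>x\<parallel> \<in> RV M"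
  using rnorm_closed by (auto simp: L0_pos_def L0_def)

lemma rv_class_carrier [simp, intro]:
  "f \<in> borel_measurable M \<Longrightarrow> rv_class M f \<in> carrier (L0 M)" for f :: "'w \<Rightarrow> real"
  by (auto simp: L0_def RV_def)

lemma nrm_measurable [measurable]: "x \<in> carrier S \<Longrightarrow> nrm x \<in> borel_measurable M"
  unfolding nrm_def by (rule rep_RV(1)) (rule rnorm_in_RV)

lemma rnorm_eq_class: "x \<in> carrier S \<Longrightarrow> \<parallel>x\<parallel> = rv_class M (nrm x)"
  unfolding nrm_def by (rule rep_RV(2)[symmetric]) (rule rnorm_in_RV)

lemma nrm_nonneg: "x \<in> carrier S \<Longrightarrow> AE \<omega> in M. 0 \<le> nrm x \<omega>"
proof -
  assume "x \<in> carrier S"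
  then have "AE \<omega> in M. rep (rv_class M (\<lambda>_. 0::real)) \<omega> \<le> nrm x \<omega>"
    using rnorm_closed by (auto simp: L0_pos_def L0_def rv_le_def nrm_def)
  then show ?thesis using rep_rv_class(2)[of "\<lambda>_. 0::real" M] by auto
qed

lemma nrm_eq_0: "\<lbrakk>x \<in> carrier S; AE \<omega> in M. nrm x \<omega> = 0\<rbrakk> \<Longrightarrow> x = \<zero>"
proof -
  assume x: "x \<in> carrier S" and "AE \<omega> in M. nrm x \<omega> = 0"
  then have "\<parallel>x\<parallel> = \<zero>\<^bsub>L0 M\<^esub>"
    using rv_class_cong[of "nrm x" "\<lambda>_. 0" M] by (simp add: rnorm_eq_class L0_def)
  then show ?thesis using rnorm_eq_zero x by blast
qed

lemma nrm_smult:
  assumes "f \<in> borel_measurable M" "x \<in> carrier S"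
  shows "AE \<omega> in M. nrm (rv_class M f \<odot> x) \<omega> = \<bar>f \<omega>\<bar> * nrm x \<omega>"
proof -
  note [measurable] = assms(1) nrm_measurable[OF assms(2)]
  have "L0_abs M (rv_class M f) = rv_class M (\<lambda>\<omega>. \<bar>f \<omega>\<bar>)"
    unfolding L0_abs_def using rep_rv_class(2)[OF assms(1)] by (intro rv_class_cong) auto
  then have "\<parallel>rv_class M f \<odot> x\<parallel> = rv_class M (\<lambda>\<omega>. \<bar>f \<omega>\<bar> * nrm x \<omega>)"
    using assms by (simp add: rnorm_smult rnorm_eq_class[of x] rv_class_mult)
  then show ?thesis unfolding nrm_def[of "rv_class M f \<odot> x"]
    using rep_rv_class(2)[of "\<lambda>\<omega>. \<bar>f \<omega>\<bar> * nrm x \<omega>" M] by simp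
qed

lemma nrm_add_le:
  assumes "x \<in> carrier S" "y \<in> carrier S"
  shows "AE \<omega> in M. nrm (x \<oplus> y) \<omega> \<le> nrm x \<omega> + nrm y \<omega>"
proof -
  note [measurable] = nrm_measurable[OF assms(1)] nrm_measurable[OF assms(2)]
  have "AE \<omega> in M. nrm (x \<oplus> y) \<omega> \<le> rep (rv_class M (\<lambda>\<omega>. nrm x \<omega> + nrm y \<omega>)) \<omega>"
    using rnorm_triangle[OF assms] unfolding rv_le_def nrm_def[of "x \<oplus> y"]
    by (simp add: rnorm_eq_class assms rv_class_add)
  then show ?thesis using rep_rv_class(2)[of "\<lambda>\<omega>. nrm x \<omega> + nrm y \<omega>" M] by auto
qed

lemma comb_closed [simp, intro]:
  "\<lbrakk>f \<in> borel_measurable M; g \<in> borel_measurable M; x \<in> carrier S; y \<in> carrier S\<rbrakk>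
    \<Longrightarrow> comb f x g y \<in> carrier S"
  by (auto simp: comb_def)

lemma smult_smult:
  assumes [measurable]: "f \<in> borel_measurable M" "g \<in> borel_measurable M" and "x \<in> carrier S"
  shows "rv_class M f \<odot> (rv_class M g \<odot> x) = rv_class M (\<lambda>\<omega>. f \<omega> * g \<omega>) \<odot> x"
  using assms by (simp add: smult_assoc1[symmetric] rv_class_mult)

lemma smult_add:
  assumes [measurable]: "f \<in> borel_measurable M" "g \<in> borel_measurable M" and "x \<in> carrier S"
  shows "rv_class M f \<odot> x \<oplus> rv_class M g \<odot> x = rv_class M (\<lambda>\<omega>. f \<omega> + g \<omega>) \<odot> x"
  using assms by (simp add: smult_l_distr[symmetric] rv_class_add)

lemma smult_1: "x \<in> carrier S \<Longrightarrow> rv_class M (\<lambda>_. 1) \<odot> x = x"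
  using smult_one by (simp add: L0_def)

lemma smult_0: "x \<in> carrier S \<Longrightarrow> rv_class M (\<lambda>_. 0) \<odot> x = \<zero>"
  using smult_l_null by (simp add: L0_def)

lemma smult_comb:
  assumes [measurable]: "c \<in> borel_measurable M" "f \<in> borel_measurable M" "g \<in> borel_measurable M"
    and "x \<in> carrier S" "y \<in> carrier S"
  shows "rv_class M c \<odot> comb f x g y = comb (\<lambda>\<omega>. c \<omega> * f \<omega>) x (\<lambda>\<omega>. c \<omega> * g \<omega>) y"
  using assms by (simp add: comb_def smult_r_distr smult_smult)

lemma comb_add:
  assumes [measurable]: "f \<in> borel_measurable M" "g \<in> borel_measurable M"
      "f' \<in> borel_measurable M" "g' \<in> borel_measurable M"
    and "x \<in> carrier S" "y \<in> carrier S"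
  shows "comb f x g y \<oplus> comb f' x g' y = comb (\<lambda>\<omega>. f \<omega> + f' \<omega>) x (\<lambda>\<omega>. g \<omega> + g' \<omega>) y"
proof -
  have "comb f x g y \<oplus> comb f' x g' y =
      (rv_class M f \<odot> x \<oplus> rv_class M f' \<odot> x) \<oplus> (rv_class M g \<odot> y \<oplus> rv_class M g' \<odot> y)"
    using assms unfolding comb_def by (simp add: M.a_ac)
  then show ?thesis using assms by (simp add: smult_add comb_def)
qed

lemma comb_comb:
  assumes [measurable]: "c \<in> borel_measurable M" "d \<in> borel_measurable M"
      "f \<in> borel_measurable M" "g \<in> borel_measurable M"
      "f' \<in> borel_measurable M" "g' \<in> borel_measurable M"
    and "x \<in> carrier S" "y \<in> carrier S"
  shows "comb c (comb f x g y) d (comb f' x g' y) =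
    comb (\<lambda>\<omega>. c \<omega> * f \<omega> + d \<omega> * f' \<omega>) x (\<lambda>\<omega>. c \<omega> * g \<omega> + d \<omega> * g' \<omega>) y"
  using assms by (simp add: comb_def[of c] smult_comb comb_add)

lemma comb_swap:
  assumes [measurable]: "f \<in> borel_measurable M" "g \<in> borel_measurable M"
    and "x \<in> carrier S" "y \<in> carrier S"
  shows "comb f x g y = comb g y f x"
  using assms by (simp add: comb_def M.a_comm)

lemma comb_1_0: "\<lbrakk>x \<in> carrier S; y \<in> carrier S\<rbrakk> \<Longrightarrow> comb (\<lambda>_. 1) x (\<lambda>_. 0) y = x"
  and comb_0_1: "\<lbrakk>x \<in> carrier S; y \<in> carrier S\<rbrakk> \<Longrightarrow> comb (\<lambda>_. 0) x (\<lambda>_. 1) y = y"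
  and comb_1_1: "\<lbrakk>x \<in> carrier S; y \<in> carrier S\<rbrakk> \<Longrightarrow> comb (\<lambda>_. 1) x (\<lambda>_. 1) y = x \<oplus> y"
  by (simp_all add: comb_def smult_1 smult_0)

lemma comb_1_m1:
  assumes "x \<in> carrier S" "y \<in> carrier S"
  shows "comb (\<lambda>_. 1) x (\<lambda>_. -1) y = x \<ominus> y"
proof -
  have "rv_class M (\<lambda>_. -1) \<odot> y \<oplus> y = \<zero>"
    using assms smult_add[of "\<lambda>_. -1" "\<lambda>_. 1" y] by (simp add: smult_1 smult_0)
  then have "rv_class M (\<lambda>_. -1) \<odot> y = \<ominus> y"
    using assms M.minus_equality[of "rv_class M (\<lambda>_. -1) \<odot> y" y] by simp
  then show ?thesis using assms by (simp add: comb_def smult_1 a_minus_def)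
qed

lemmas comb_basis = comb_1_0 comb_0_1 comb_1_1 comb_1_m1

lemma nrm_comb_scale:
  assumes "c \<in> borel_measurable M" "f \<in> borel_measurable M" "g \<in> borel_measurable M"
    and "x \<in> carrier S" "y \<in> carrier S"
  shows "AE \<omega> in M. nrm (comb (\<lambda>\<omega>. c \<omega> * f \<omega>) x (\<lambda>\<omega>. c \<omega> * g \<omega>) y) \<omega> = \<bar>c \<omega>\<bar> * nrm (comb f x g y) \<omega>"
  using nrm_smult[OF assms(1) comb_closed[OF assms(2-5)]] assms by (simp add: smult_comb)

text \<open>The single form in which the triangle inequality is applied: a linear relation
  \<open>b z = c z\<^sub>1 + d z\<^sub>2\<close> between vectors of the plane, checked in coordinates.\<close>

lemma nrm_comb_le:
  assumes m: "b \<in> borel_measurable M" "f \<in> borel_measurable M" "g \<in> borel_measurable M"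
      "c \<in> borel_measurable M" "f1 \<in> borel_measurable M" "g1 \<in> borel_measurable M"
      "d \<in> borel_measurable M" "f2 \<in> borel_measurable M" "g2 \<in> borel_measurable M"
    and xy: "x \<in> carrier S" "y \<in> carrier S"
    and f: "\<And>\<omega>. b \<omega> * f \<omega> = c \<omega> * f1 \<omega> + d \<omega> * f2 \<omega>"
    and g: "\<And>\<omega>. b \<omega> * g \<omega> = c \<omega> * g1 \<omega> + d \<omega> * g2 \<omega>"
  shows "AE \<omega> in M. \<bar>b \<omega>\<bar> * nrm (comb f x g y) \<omega> \<le>
    \<bar>c \<omega>\<bar> * nrm (comb f1 x g1 y) \<omega> + \<bar>d \<omega>\<bar> * nrm (comb f2 x g2 y) \<omega>"
proof -
  note [measurable] = m
  have "rv_class M b \<odot> comb f x g y = rv_class M c \<odot> comb f1 x g1 y \<oplus> rv_class M d \<odot> comb f2 x g2 y"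
    using xy m by (simp add: smult_comb f g comb_add)
  then have "AE \<omega> in M. nrm (rv_class M b \<odot> comb f x g y) \<omega> \<le>
      nrm (rv_class M c \<odot> comb f1 x g1 y) \<omega> + nrm (rv_class M d \<odot> comb f2 x g2 y) \<omega>"
    using nrm_add_le[of "rv_class M c \<odot> comb f1 x g1 y" "rv_class M d \<odot> comb f2 x g2 y"] xy m by simp
  moreover have "AE \<omega> in M. nrm (rv_class M b \<odot> comb f x g y) \<omega> = \<bar>b \<omega>\<bar> * nrm (comb f x g y) \<omega>"
      "AE \<omega> in M. nrm (rv_class M c \<odot> comb f1 x g1 y) \<omega> = \<bar>c \<omega>\<bar> * nrm (comb f1 x g1 y) \<omega>"
      "AE \<omega> in M. nrm (rv_class M d \<odot> comb f2 x g2 y) \<omega> = \<bar>d \<omega>\<bar> * nrm (comb f2 x g2 y) \<omega>"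
    using xy m by (auto intro!: nrm_smult)
  ultimately show ?thesis by eventually_elim simp
qed

lemma nrm_comb_lipschitz:
  assumes m: "f \<in> borel_measurable M" "g \<in> borel_measurable M"
      "f' \<in> borel_measurable M" "g' \<in> borel_measurable M"
    and xy: "x \<in> carrier S" "y \<in> carrier S"
  shows "AE \<omega> in M. \<bar>nrm (comb f x g y) \<omega> - nrm (comb f' x g' y) \<omega>\<bar>
    \<le> \<bar>f \<omega> - f' \<omega>\<bar> * nrm x \<omega> + \<bar>g \<omega> - g' \<omega>\<bar> * nrm y \<omega>"
proof -
  note [measurable] = m
  have d: "AE \<omega> in M. nrm (comb (\<lambda>\<omega>. f \<omega> - f' \<omega>) x (\<lambda>\<omega>. g \<omega> - g' \<omega>) y) \<omega>
      \<le> \<bar>f \<omega> - f' \<omega>\<bar> * nrm x \<omega> + \<bar>g \<omega> - g' \<omega>\<bar> * nrm y \<omega>"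
    using nrm_comb_le[of "\<lambda>_. 1" "\<lambda>\<omega>. f \<omega> - f' \<omega>" "\<lambda>\<omega>. g \<omega> - g' \<omega>" "\<lambda>\<omega>. f \<omega> - f' \<omega>" "\<lambda>_. 1" "\<lambda>_. 0"
        "\<lambda>\<omega>. g \<omega> - g' \<omega>" "\<lambda>_. 0" "\<lambda>_. 1" x y] m xy by (simp add: comb_basis)
  have 1: "AE \<omega> in M. nrm (comb f x g y) \<omega> \<le> nrm (comb f' x g' y) \<omega> + nrm (comb (\<lambda>\<omega>. f \<omega> - f' \<omega>) x (\<lambda>\<omega>. g \<omega> - g' \<omega>) y) \<omega>"
    using nrm_comb_le[of "\<lambda>_. 1" f g "\<lambda>_. 1" f' g' "\<lambda>_. 1" "\<lambda>\<omega>. f \<omega> - f' \<omega>" "\<lambda>\<omega>. g \<omega> - g' \<omega>" x y] m xy by simp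
  have 2: "AE \<omega> in M. nrm (comb f' x g' y) \<omega> \<le> nrm (comb f x g y) \<omega> + nrm (comb (\<lambda>\<omega>. f \<omega> - f' \<omega>) x (\<lambda>\<omega>. g \<omega> - g' \<omega>) y) \<omega>"
    using nrm_comb_le[of "\<lambda>_. 1" f' g' "\<lambda>_. 1" f g "\<lambda>_. -1" "\<lambda>\<omega>. f \<omega> - f' \<omega>" "\<lambda>\<omega>. g \<omega> - g' \<omega>" x y] m xy by simp
  show ?thesis using d 1 2 by eventually_elim linarith
qed

section \<open>Moving points of the unit ball\<close>

lemma nrm_minus_commute:
  assumes "x \<in> carrier S" "y \<in> carrier S"
  shows "AE \<omega> in M. nrm (x \<ominus> y) \<omega> = nrm (y \<ominus> x) \<omega>"
  using nrm_comb_scale[of "\<lambda>_. -1" "\<lambda>_. 1" "\<lambda>_. -1" y x] assms comb_swap[of "\<lambda>_. -1" "\<lambda>_. 1" y x]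
  by (simp add: comb_basis)

text \<open>With \<open>p = \<parallel>x - y\<parallel>\<close>, \<open>q = \<parallel>x + y\<parallel>\<close> and \<open>v = p (x + y) - q (x - y)\<close>, the vector \<open>y' = y + s v\<close> for
  \<open>s \<ge> 0\<close> satisfies \<open>(1 + s p) (x + y) = (x + y') + s q (x - y)\<close> and
  \<open>(1 + s q) (x - y) = (x - y') + s p (x + y)\<close>. Taking norms gives \<open>\<parallel>x + y'\<parallel> \<ge> q\<close> and
  \<open>\<parallel>x - y'\<parallel> \<ge> p\<close>. Moreover \<open>(p + q) (x + y) = 2 q x + v\<close>, so \<open>v = 0\<close> would give
  \<open>(p + q) q \<le> 2 q\<close>, against \<open>p + q > 2\<close>; here \<open>q > 0\<close> since \<open>p \<le> 2\<close>.\<close>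

lemma push_to_sphere:
  assumes xy: "x \<in> carrier S" "y \<in> carrier S"
    and ball: "AE \<omega> in M. \<omega> \<in> D \<longrightarrow> nrm x \<omega> \<le> 1 \<and> nrm y \<omega> \<le> 1"
    and gt: "AE \<omega> in M. \<omega> \<in> D \<longrightarrow> nrm (x \<oplus> y) \<omega> + nrm (x \<ominus> y) \<omega> > 2"
  obtains y' where "y' \<in> carrier S" "AE \<omega> in M. \<omega> \<in> D \<longrightarrow> nrm y' \<omega> = 1 \<and>
    nrm (x \<oplus> y) \<omega> \<le> nrm (x \<oplus> y') \<omega> \<and> nrm (x \<ominus> y) \<omega> \<le> nrm (x \<ominus> y') \<omega>"
proof -
  define p where "p = nrm (x \<ominus> y)"
  define q where "q = nrm (x \<oplus> y)"
  have [measurable]: "p \<in> borel_measurable M" "q \<in> borel_measurable M"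
    using xy by (auto simp: p_def q_def)
  define r where "r = nrm (comb (\<lambda>\<omega>. p \<omega> - q \<omega>) x (\<lambda>\<omega>. p \<omega> + q \<omega>) y)"
  have [measurable]: "r \<in> borel_measurable M" unfolding r_def using xy by (intro nrm_measurable comb_closed) auto
  \<comment> \<open>The coordinates of \<open>v / \<parallel>v\<parallel>\<close> in terms of \<open>x\<close> and \<open>y\<close>.\<close>
  define a where "a \<omega> = (p \<omega> - q \<omega>) / r \<omega>" for \<omega>
  define b where "b \<omega> = (p \<omega> + q \<omega>) / r \<omega>" for \<omega>
  have [measurable]: "a \<in> borel_measurable M" "b \<in> borel_measurable M"
    unfolding a_def b_def by measurable
  have pos: "AE \<omega> in M. 0 \<le> p \<omega> \<and> 0 \<le> q \<omega> \<and> 0 \<le> r \<omega>"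
    unfolding p_def q_def r_def using xy by (intro AE_conjI nrm_nonneg) auto
  have p_le: "AE \<omega> in M. p \<omega> \<le> nrm x \<omega> + nrm y \<omega>"
    using nrm_comb_le[of "\<lambda>_. 1" "\<lambda>_. 1" "\<lambda>_. -1" "\<lambda>_. 1" "\<lambda>_. 1" "\<lambda>_. 0" "\<lambda>_. -1" "\<lambda>_. 0" "\<lambda>_. 1" x y] xy
    by (simp add: comb_basis p_def)
  have "AE \<omega> in M. \<bar>1\<bar> * nrm (comb (\<lambda>\<omega>. p \<omega> + q \<omega>) x (\<lambda>\<omega>. p \<omega> + q \<omega>) y) \<omega> \<le>
      \<bar>2 * q \<omega>\<bar> * nrm (comb (\<lambda>_. 1) x (\<lambda>_. 0) y) \<omega> + \<bar>1\<bar> * r \<omega>"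
    unfolding r_def using xy by (intro nrm_comb_le) auto
  moreover have "AE \<omega> in M. nrm (comb (\<lambda>\<omega>. p \<omega> + q \<omega>) x (\<lambda>\<omega>. p \<omega> + q \<omega>) y) \<omega> = \<bar>p \<omega> + q \<omega>\<bar> * q \<omega>"
    using nrm_comb_scale[of "\<lambda>\<omega>. p \<omega> + q \<omega>" "\<lambda>_. 1" "\<lambda>_. 1" x y] xy by (simp add: comb_basis q_def)
  ultimately have r_pos: "AE \<omega> in M. \<omega> \<in> D \<longrightarrow> 0 < r \<omega>"
    using pos p_le ball gt
  proof eventually_elim
    case (elim \<omega>)
    show ?case
    proof
      assume D: "\<omega> \<in> D"
      then have *: "(p \<omega> + q \<omega>) * q \<omega> \<le> 2 * q \<omega> * nrm x \<omega> + r \<omega>" "nrm x \<omega> \<le> 1" "0 \<le> q \<omega>"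
          "q \<omega> + p \<omega> > 2" "p \<omega> \<le> 2"
        using elim xy by (auto simp: comb_basis p_def q_def)
      then have "2 * q \<omega> * nrm x \<omega> \<le> 2 * q \<omega>" "q \<omega> > 0" by (auto intro: mult_left_le)
      moreover from this * have "2 * q \<omega> < (p \<omega> + q \<omega>) * q \<omega>" by simp
      ultimately show "0 < r \<omega>" using * by linarith
    qed
  qed
  define F where "F f = nrm (comb (\<lambda>\<omega>. f \<omega> * a \<omega>) x (\<lambda>\<omega>. 1 + f \<omega> * b \<omega>) y)" for f
  have w: "AE \<omega> in M. nrm (comb a x b y) \<omega> = \<bar>1 / r \<omega>\<bar> * r \<omega>"
    using nrm_comb_scale[of "\<lambda>\<omega>. 1 / r \<omega>" "\<lambda>\<omega>. p \<omega> - q \<omega>" "\<lambda>\<omega>. p \<omega> + q \<omega>" x y] xy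
    by (simp add: a_def[abs_def] b_def[abs_def] r_def)
  have F2: "AE \<omega> in M. \<bar>2\<bar> * nrm (comb a x b y) \<omega> \<le> \<bar>1\<bar> * F (\<lambda>_. 2) \<omega> + \<bar>-1\<bar> * nrm (comb (\<lambda>_. 0) x (\<lambda>_. 1) y) \<omega>"
    unfolding F_def using xy by (intro nrm_comb_le) auto
  \<comment> \<open>At time \<open>2\<close> the moving point has left the open ball: its norm is at least \<open>2 - \<parallel>y\<parallel>\<close>.\<close>
  obtain t where t[measurable]: "t \<in> borel_measurable M" and t0: "\<And>\<omega>. 0 \<le> t \<omega>"
    and Ft: "AE \<omega> in M. \<omega> \<in> D \<longrightarrow> F t \<omega> = 1"
  proof (rule measurable_intermediate_value[of M F "\<lambda>_. 1" 1 2 D])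
    fix f g :: "'w \<Rightarrow> real"
    assume [measurable]: "f \<in> borel_measurable M" "g \<in> borel_measurable M"
    have 1: "AE \<omega> in M. \<bar>1\<bar> * F f \<omega> \<le> \<bar>1\<bar> * F g \<omega> + \<bar>f \<omega> - g \<omega>\<bar> * nrm (comb a x b y) \<omega>"
      unfolding F_def using xy by (intro nrm_comb_le) (auto simp: algebra_simps)
    have 2: "AE \<omega> in M. \<bar>1\<bar> * F g \<omega> \<le> \<bar>1\<bar> * F f \<omega> + \<bar>g \<omega> - f \<omega>\<bar> * nrm (comb a x b y) \<omega>"
      unfolding F_def using xy by (intro nrm_comb_le) (auto simp: algebra_simps)
    show "AE \<omega> in M. \<omega> \<in> D \<longrightarrow> \<bar>F f \<omega> - F g \<omega>\<bar> \<le> 1 * \<bar>f \<omega> - g \<omega>\<bar>"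
      using 1 2 w r_pos by eventually_elim (auto simp: abs_minus_commute)
  next
    show "AE \<omega> in M. \<omega> \<in> D \<longrightarrow> F (\<lambda>_. 0) \<omega> \<le> 1"
      using ball xy by (simp add: F_def comb_basis) (auto elim: eventually_mono)
    show "AE \<omega> in M. \<omega> \<in> D \<longrightarrow> 1 \<le> F (\<lambda>_. 2) \<omega>"
      using F2 w r_pos ball by eventually_elim (auto simp: comb_basis xy)
  qed (use xy in \<open>auto simp: F_def\<close>)
  define y' where "y' = comb (\<lambda>\<omega>. t \<omega> * a \<omega>) x (\<lambda>\<omega>. 1 + t \<omega> * b \<omega>) y"
  have y': "y' \<in> carrier S" unfolding y'_def using xy by auto
  have xy'_plus: "x \<oplus> y' = comb (\<lambda>\<omega>. 1 + t \<omega> * a \<omega>) x (\<lambda>\<omega>. 1 + t \<omega> * b \<omega>) y"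
    using comb_add[of "\<lambda>_. 1" "\<lambda>_. 0" "\<lambda>\<omega>. t \<omega> * a \<omega>" "\<lambda>\<omega>. 1 + t \<omega> * b \<omega>" x y] xy
    by (simp add: y'_def comb_basis)
  have xy'_minus: "x \<ominus> y' = comb (\<lambda>\<omega>. 1 - t \<omega> * a \<omega>) x (\<lambda>\<omega>. - 1 - t \<omega> * b \<omega>) y"
    using comb_comb[of "\<lambda>_. 1" "\<lambda>_. -1" "\<lambda>_. 1" "\<lambda>_. 0" "\<lambda>\<omega>. t \<omega> * a \<omega>" "\<lambda>\<omega>. 1 + t \<omega> * b \<omega>" x y] xy y'
    by (simp add: y'_def[symmetric] comb_basis)
  define s where "s \<omega> = t \<omega> / r \<omega>" for \<omega>
  have [measurable]: "s \<in> borel_measurable M" unfolding s_def by measurable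
  have ta: "t \<omega> * a \<omega> = s \<omega> * (p \<omega> - q \<omega>)" and tb: "t \<omega> * b \<omega> = s \<omega> * (p \<omega> + q \<omega>)" for \<omega>
    by (simp_all add: a_def b_def s_def)
  have q_le: "AE \<omega> in M. \<bar>1 + s \<omega> * p \<omega>\<bar> * nrm (comb (\<lambda>_. 1) x (\<lambda>_. 1) y) \<omega> \<le>
      \<bar>1\<bar> * nrm (x \<oplus> y') \<omega> + \<bar>s \<omega> * q \<omega>\<bar> * nrm (comb (\<lambda>_. 1) x (\<lambda>_. -1) y) \<omega>"
    unfolding xy'_plus ta tb using xy by (intro nrm_comb_le) (auto simp: algebra_simps)
  have p_le': "AE \<omega> in M. \<bar>1 + s \<omega> * q \<omega>\<bar> * nrm (comb (\<lambda>_. 1) x (\<lambda>_. -1) y) \<omega> \<le>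
      \<bar>1\<bar> * nrm (x \<ominus> y') \<omega> + \<bar>s \<omega> * p \<omega>\<bar> * nrm (comb (\<lambda>_. 1) x (\<lambda>_. 1) y) \<omega>"
    unfolding xy'_minus ta tb using xy by (intro nrm_comb_le) (auto simp: algebra_simps)
  have "AE \<omega> in M. \<omega> \<in> D \<longrightarrow> nrm y' \<omega> = 1 \<and>
    nrm (x \<oplus> y) \<omega> \<le> nrm (x \<oplus> y') \<omega> \<and> nrm (x \<ominus> y) \<omega> \<le> nrm (x \<ominus> y') \<omega>"
    using q_le p_le' pos Ft
  proof eventually_elim
    case (elim \<omega>)
    have "0 \<le> s \<omega>" using t0 elim by (simp add: s_def)
    then have "0 \<le> s \<omega> * p \<omega>" "0 \<le> s \<omega> * q \<omega>" using elim by auto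
    then show ?case using elim xy
      by (simp add: comb_basis p_def[symmetric] q_def[symmetric] F_def y'_def algebra_simps)
  qed
  then show thesis using that y' by blast
qed

text \<open>The broken line from \<open>x\<close> at time \<open>0\<close> through \<open>y\<close> at time \<open>1\<close> to \<open>-x\<close> at time \<open>2\<close>. Its first half
  serves to slide \<open>y\<close> towards \<open>x\<close>, the whole of it to find points at every distance up to \<open>2\<close>
  from \<open>x\<close>.\<close>

definition bent_path :: "'s \<Rightarrow> 's \<Rightarrow> ('w \<Rightarrow> real) \<Rightarrow> 's" where
  "bent_path x y f = comb (\<lambda>\<omega>. 1 - f \<omega>) x (\<lambda>\<omega>. 1 - \<bar>1 - f \<omega>\<bar>) y"

lemma bent_path_closed [simp, intro]:
  "\<lbrakk>f \<in> borel_measurable M; x \<in> carrier S; y \<in> carrier S\<rbrakk> \<Longrightarrow> bent_path x y f \<in> carrier S"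
  unfolding bent_path_def by auto

text \<open>For a point \<open>z\<close> of the path, \<open>\<parallel>x - z / \<parallel>z\<parallel>\<parallel> = \<epsilon>\<close> is equivalent to the vanishing of
  \<open>\<parallel>\<parallel>z\<parallel> x - z\<parallel> - \<epsilon> \<parallel>z\<parallel>\<close>. Clearing the denominator matters: \<open>\<parallel>z\<parallel>\<close> has no lower bound that is
  uniform over \<open>D\<close>, whereas this expression is Lipschitz in the time with the constant \<open>8\<close>.\<close>

lemma bent_path_hits_sphere:
  assumes xy: "x \<in> carrier S" "y \<in> carrier S"
    and unit: "AE \<omega> in M. \<omega> \<in> D \<longrightarrow> nrm x \<omega> = 1 \<and> nrm y \<omega> = 1"
    and \<epsilon>[measurable]: "\<epsilon> \<in> borel_measurable M"
    and \<epsilon>_range: "AE \<omega> in M. \<omega> \<in> D \<longrightarrow> 0 \<le> \<epsilon> \<omega> \<and> \<epsilon> \<omega> \<le> 2"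
    and T: "0 \<le> T"
    and nz: "\<And>f. \<lbrakk>f \<in> borel_measurable M; \<And>\<omega>. 0 \<le> f \<omega>; \<And>\<omega>. f \<omega> \<le> T\<rbrakk> \<Longrightarrow>
      AE \<omega> in M. \<omega> \<in> D \<longrightarrow> 0 < nrm (bent_path x y f) \<omega>"
    and far: "AE \<omega> in M. \<omega> \<in> D \<longrightarrow> nrm (bent_path x y (\<lambda>_. T)) \<omega> = 1 \<and>
      \<epsilon> \<omega> \<le> nrm (x \<ominus> bent_path x y (\<lambda>_. T)) \<omega>"
  obtains t y' where "t \<in> borel_measurable M" "\<And>\<omega>. 0 \<le> t \<omega>" "\<And>\<omega>. t \<omega> \<le> T"
    "y' = rv_class M (\<lambda>\<omega>. 1 / nrm (bent_path x y t) \<omega>) \<odot> bent_path x y t"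
    "AE \<omega> in M. \<omega> \<in> D \<longrightarrow> nrm y' \<omega> = 1 \<and> nrm (x \<ominus> y') \<omega> = \<epsilon> \<omega>"
proof -
  define N where "N f = nrm (bent_path x y f)" for f
  have N_meas[measurable]: "N f \<in> borel_measurable M" if [measurable]: "f \<in> borel_measurable M" for f
    unfolding N_def using xy by auto
  define G where "G f = nrm (comb (\<lambda>\<omega>. N f \<omega> - (1 - f \<omega>)) x (\<lambda>\<omega>. - (1 - \<bar>1 - f \<omega>\<bar>)) y)" for f
  have G_meas[measurable]: "G f \<in> borel_measurable M" if [measurable]: "f \<in> borel_measurable M" for f
    unfolding G_def using xy by (intro nrm_measurable comb_closed) auto
  have G_eq: "G f = nrm (comb (N f) x (\<lambda>_. -1) (bent_path x y f))" if [measurable]: "f \<in> borel_measurable M" for f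
    using comb_comb[of "N f" "\<lambda>_. -1" "\<lambda>_. 1" "\<lambda>_. 0" "\<lambda>\<omega>. 1 - f \<omega>" "\<lambda>\<omega>. 1 - \<bar>1 - f \<omega>\<bar>" x y] xy
    by (simp add: G_def comb_basis bent_path_def algebra_simps)
  have lipN: "AE \<omega> in M. \<omega> \<in> D \<longrightarrow> \<bar>N f \<omega> - N g \<omega>\<bar> \<le> 2 * \<bar>f \<omega> - g \<omega>\<bar>"
    if [measurable]: "f \<in> borel_measurable M" "g \<in> borel_measurable M" for f g
  proof -
    have "AE \<omega> in M. \<bar>N f \<omega> - N g \<omega>\<bar> \<le> \<bar>(1 - f \<omega>) - (1 - g \<omega>)\<bar> * nrm x \<omega>
        + \<bar>(1 - \<bar>1 - f \<omega>\<bar>) - (1 - \<bar>1 - g \<omega>\<bar>)\<bar> * nrm y \<omega>"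
      unfolding N_def bent_path_def using xy by (intro nrm_comb_lipschitz) auto
    then show ?thesis using unit
    proof eventually_elim
      case (elim \<omega>)
      show ?case
      proof
        assume "\<omega> \<in> D"
        then have "\<bar>N f \<omega> - N g \<omega>\<bar> \<le> \<bar>(1 - f \<omega>) - (1 - g \<omega>)\<bar> + \<bar>(1 - \<bar>1 - f \<omega>\<bar>) - (1 - \<bar>1 - g \<omega>\<bar>)\<bar>"
          using elim by simp
        then show "\<bar>N f \<omega> - N g \<omega>\<bar> \<le> 2 * \<bar>f \<omega> - g \<omega>\<bar>" by (smt (verit))
      qed
    qed
  qed
  have lipG: "AE \<omega> in M. \<omega> \<in> D \<longrightarrow> \<bar>G f \<omega> - G g \<omega>\<bar> \<le> 4 * \<bar>f \<omega> - g \<omega>\<bar>"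
    if [measurable]: "f \<in> borel_measurable M" "g \<in> borel_measurable M" for f g
  proof -
    have "AE \<omega> in M. \<bar>G f \<omega> - G g \<omega>\<bar> \<le> \<bar>(N f \<omega> - (1 - f \<omega>)) - (N g \<omega> - (1 - g \<omega>))\<bar> * nrm x \<omega>
        + \<bar>- (1 - \<bar>1 - f \<omega>\<bar>) - - (1 - \<bar>1 - g \<omega>\<bar>)\<bar> * nrm y \<omega>"
      unfolding G_def using xy by (intro nrm_comb_lipschitz) auto
    then show ?thesis using unit lipN[OF that]
    proof eventually_elim
      case (elim \<omega>)
      show ?case
      proof
        assume D: "\<omega> \<in> D"
        then have "\<bar>G f \<omega> - G g \<omega>\<bar> \<le> \<bar>(N f \<omega> - (1 - f \<omega>)) - (N g \<omega> - (1 - g \<omega>))\<bar>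
            + \<bar>- (1 - \<bar>1 - f \<omega>\<bar>) - - (1 - \<bar>1 - g \<omega>\<bar>)\<bar>"
          using elim by simp
        moreover have "\<bar>N f \<omega> - N g \<omega>\<bar> \<le> 2 * \<bar>f \<omega> - g \<omega>\<bar>" using elim D by simp
        ultimately show "\<bar>G f \<omega> - G g \<omega>\<bar> \<le> 4 * \<bar>f \<omega> - g \<omega>\<bar>" by (smt (verit))
      qed
    qed
  qed
  obtain t where t[measurable]: "t \<in> borel_measurable M" and t0: "\<And>\<omega>. 0 \<le> t \<omega>" and tT: "\<And>\<omega>. t \<omega> \<le> T"
    and root: "AE \<omega> in M. \<omega> \<in> D \<longrightarrow> G t \<omega> - \<epsilon> \<omega> * N t \<omega> = 0"
  proof (rule measurable_intermediate_value[of M "\<lambda>f \<omega>. G f \<omega> - \<epsilon> \<omega> * N f \<omega>" "\<lambda>_. 0" 8 T D])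
    fix f g :: "'w \<Rightarrow> real"
    assume fg: "f \<in> borel_measurable M" "g \<in> borel_measurable M"
    show "AE \<omega> in M. \<omega> \<in> D \<longrightarrow>
        \<bar>(G f \<omega> - \<epsilon> \<omega> * N f \<omega>) - (G g \<omega> - \<epsilon> \<omega> * N g \<omega>)\<bar> \<le> 8 * \<bar>f \<omega> - g \<omega>\<bar>"
      using lipN[OF fg] lipG[OF fg] \<epsilon>_range
    proof eventually_elim
      case (elim \<omega>)
      show ?case
      proof
        assume D: "\<omega> \<in> D"
        have "\<bar>\<epsilon> \<omega> * (N f \<omega> - N g \<omega>)\<bar> \<le> 2 * (2 * \<bar>f \<omega> - g \<omega>\<bar>)"
          unfolding abs_mult using elim D by (intro mult_mono) auto
        then show "\<bar>(G f \<omega> - \<epsilon> \<omega> * N f \<omega>) - (G g \<omega> - \<epsilon> \<omega> * N g \<omega>)\<bar> \<le> 8 * \<bar>f \<omega> - g \<omega>\<bar>"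
          using elim D by (simp add: right_diff_distrib)
      qed
    qed
  next
    have "bent_path x y (\<lambda>_. 0) = x" using xy by (simp add: bent_path_def comb_basis)
    then have "AE \<omega> in M. \<bar>N (\<lambda>_. 0) \<omega> - 1\<bar> * nrm x \<omega> = G (\<lambda>_. 0) \<omega>" "N (\<lambda>_. 0) = nrm x"
      using nrm_comb_scale[of "\<lambda>\<omega>. N (\<lambda>_. 0) \<omega> - 1" "\<lambda>_. 1" "\<lambda>_. 0" x y] xy
      by (auto simp: comb_basis G_def N_def elim: eventually_mono)
    then show "AE \<omega> in M. \<omega> \<in> D \<longrightarrow> G (\<lambda>_. 0) \<omega> - \<epsilon> \<omega> * N (\<lambda>_. 0) \<omega> \<le> 0"
      using unit \<epsilon>_range by (auto elim!: eventually_elim2)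
  next
    have "AE \<omega> in M. \<bar>1\<bar> * nrm (comb (\<lambda>_. 1) x (\<lambda>_. -1) (bent_path x y (\<lambda>_. T))) \<omega> \<le>
        \<bar>1\<bar> * nrm (comb (N (\<lambda>_. T)) x (\<lambda>_. -1) (bent_path x y (\<lambda>_. T))) \<omega>
        + \<bar>1 - N (\<lambda>_. T) \<omega>\<bar> * nrm (comb (\<lambda>_. 1) x (\<lambda>_. 0) (bent_path x y (\<lambda>_. T))) \<omega>"
      using xy by (intro nrm_comb_le) auto
    then show "AE \<omega> in M. \<omega> \<in> D \<longrightarrow> 0 \<le> G (\<lambda>_. T) \<omega> - \<epsilon> \<omega> * N (\<lambda>_. T) \<omega>"
      using far by eventually_elim (auto simp: comb_basis xy G_eq N_def[symmetric])
  qed (use T in auto)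
  define y' where "y' = rv_class M (\<lambda>\<omega>. 1 / N t \<omega>) \<odot> bent_path x y t"
  have y': "y' \<in> carrier S" unfolding y'_def using xy by auto
  have 1: "AE \<omega> in M. nrm y' \<omega> = \<bar>1 / N t \<omega>\<bar> * N t \<omega>"
    unfolding y'_def N_def[of t] using xy by (intro nrm_smult) (auto simp: N_def[symmetric])
  have "x \<ominus> y' = comb (\<lambda>_. 1) x (\<lambda>\<omega>. - (1 / N t \<omega>)) (bent_path x y t)"
    using comb_comb[of "\<lambda>_. 1" "\<lambda>_. -1" "\<lambda>_. 1" "\<lambda>_. 0" "\<lambda>_. 0" "\<lambda>\<omega>. 1 / N t \<omega>" x "bent_path x y t"] xy y'
    by (simp add: comb_basis comb_def[of "\<lambda>_. 0"] smult_0 y'_def)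
  then have 2: "AE \<omega> in M. \<bar>N t \<omega>\<bar> * nrm (x \<ominus> y') \<omega> =
      nrm (comb (\<lambda>\<omega>. N t \<omega> * 1) x (\<lambda>\<omega>. N t \<omega> * - (1 / N t \<omega>)) (bent_path x y t)) \<omega>"
    using nrm_comb_scale[of "N t" "\<lambda>_. 1" "\<lambda>\<omega>. - (1 / N t \<omega>)" x "bent_path x y t"] xy
    by (auto elim: eventually_mono)
  have 3: "AE \<omega> in M. \<bar>nrm (comb (\<lambda>\<omega>. N t \<omega> * 1) x (\<lambda>\<omega>. N t \<omega> * - (1 / N t \<omega>)) (bent_path x y t)) \<omega> -
      nrm (comb (N t) x (\<lambda>_. -1) (bent_path x y t)) \<omega>\<bar> \<le> \<bar>N t \<omega> * 1 - N t \<omega>\<bar> * nrm x \<omega>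
      + \<bar>N t \<omega> * - (1 / N t \<omega>) - -1\<bar> * N t \<omega>"
    unfolding N_def[of t] using xy by (intro nrm_comb_lipschitz) (auto simp: N_def[symmetric])
  have "AE \<omega> in M. \<omega> \<in> D \<longrightarrow> 0 < N t \<omega>"
    unfolding N_def using t0 tT by (intro nz) auto
  then have "AE \<omega> in M. \<omega> \<in> D \<longrightarrow> nrm y' \<omega> = 1 \<and> nrm (x \<ominus> y') \<omega> = \<epsilon> \<omega>"
    using root 1 2 3 by eventually_elim (auto simp: G_eq)
  then show thesis using that[OF t t0 tT] by (simp add: y'_def N_def)
qed

text \<open>Write \<open>y' = a x + b y\<close> with \<open>a, b \<ge> 0\<close> for the normalised point of the segment at distance \<open>\<epsilon>\<close> from
  \<open>x\<close>. From \<open>b (1 + a) (x + y) = (1 + a - b) b y + b (x + y')\<close> and \<open>b = \<parallel>y' - a x\<parallel> \<le> 1 + a\<close> one gets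
  \<open>(1 + a) \<parallel>x + y\<parallel> \<le> (1 + a - b) + \<parallel>x + y'\<parallel>\<close>, and \<open>(1 + a) y' = a (x + y') + b y\<close> gives
  \<open>1 + a - b \<le> a \<parallel>x + y'\<parallel>\<close>. Adding the two, \<open>\<parallel>x + y\<parallel> \<le> \<parallel>x + y'\<parallel>\<close>. The segment misses the origin
  because \<open>y \<noteq> -x\<close>.\<close>

lemma slide_along_arc:
  assumes xy: "x \<in> carrier S" "y \<in> carrier S"
    and unit: "AE \<omega> in M. \<omega> \<in> D \<longrightarrow> nrm x \<omega> = 1 \<and> nrm y \<omega> = 1"
    and \<epsilon>[measurable]: "\<epsilon> \<in> borel_measurable M"
    and \<epsilon>_range: "AE \<omega> in M. \<omega> \<in> D \<longrightarrow> 0 < \<epsilon> \<omega> \<and> \<epsilon> \<omega> \<le> 2"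
    and far: "AE \<omega> in M. \<omega> \<in> D \<longrightarrow> \<epsilon> \<omega> \<le> nrm (x \<ominus> y) \<omega>"
    and pos: "AE \<omega> in M. \<omega> \<in> D \<longrightarrow> 0 < nrm (x \<oplus> y) \<omega>"
  obtains y' where "y' \<in> carrier S" "AE \<omega> in M. \<omega> \<in> D \<longrightarrow> nrm y' \<omega> = 1 \<and>
    nrm (x \<ominus> y') \<omega> = \<epsilon> \<omega> \<and> nrm (x \<oplus> y) \<omega> \<le> nrm (x \<oplus> y') \<omega>"
proof -
  have bent_path1: "bent_path x y (\<lambda>_. 1) = y" using xy by (simp add: bent_path_def comb_basis)
  have bent_path_pos: "AE \<omega> in M. \<omega> \<in> D \<longrightarrow> 0 < nrm (bent_path x y f) \<omega>"
    if [measurable]: "f \<in> borel_measurable M" and "\<And>\<omega>. 0 \<le> f \<omega>" "\<And>\<omega>. f \<omega> \<le> 1" for f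
  proof -
    have eq: "bent_path x y f = comb (\<lambda>\<omega>. 1 - f \<omega>) x f y" using that by (simp add: bent_path_def)
    have "AE \<omega> in M. \<bar>1 - f \<omega>\<bar> * nrm (comb (\<lambda>_. 1) x (\<lambda>_. 0) y) \<omega> \<le> \<bar>1\<bar> * nrm (bent_path x y f) \<omega>
        + \<bar>- f \<omega>\<bar> * nrm (comb (\<lambda>_. 0) x (\<lambda>_. 1) y) \<omega>"
      unfolding eq using xy by (intro nrm_comb_le) auto
    moreover have "AE \<omega> in M. \<bar>f \<omega>\<bar> * nrm (comb (\<lambda>_. 0) x (\<lambda>_. 1) y) \<omega> \<le> \<bar>1\<bar> * nrm (bent_path x y f) \<omega>
        + \<bar>- (1 - f \<omega>)\<bar> * nrm (comb (\<lambda>_. 1) x (\<lambda>_. 0) y) \<omega>"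
      unfolding eq using xy by (intro nrm_comb_le) auto
    moreover have "AE \<omega> in M. \<bar>1\<bar> * nrm (comb (\<lambda>_. 1) x (\<lambda>_. 1) y) \<omega> \<le> \<bar>2\<bar> * nrm (bent_path x y f) \<omega>
        + \<bar>- (1 - 2 * f \<omega>)\<bar> * nrm (comb (\<lambda>_. 1) x (\<lambda>_. -1) y) \<omega>"
      unfolding eq using xy by (intro nrm_comb_le) auto
    ultimately show ?thesis using unit pos
    proof eventually_elim
      case (elim \<omega>)
      show ?case
      proof (rule impI, rule ccontr)
        assume D: "\<omega> \<in> D" and "\<not> 0 < nrm (bent_path x y f) \<omega>"
        moreover have "1 - 2 * f \<omega> = 0"
          using calculation elim(1,2,4) that(2,3)[of \<omega>] xy by (simp add: comb_basis)
        ultimately show False using elim(3,5) xy by (simp add: comb_basis)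
      qed
    qed
  qed
  have "AE \<omega> in M. \<omega> \<in> D \<longrightarrow> 0 \<le> \<epsilon> \<omega> \<and> \<epsilon> \<omega> \<le> 2" using \<epsilon>_range by eventually_elim auto
  moreover have "AE \<omega> in M. \<omega> \<in> D \<longrightarrow> nrm (bent_path x y (\<lambda>_. 1)) \<omega> = 1 \<and> \<epsilon> \<omega> \<le> nrm (x \<ominus> bent_path x y (\<lambda>_. 1)) \<omega>"
    unfolding bent_path1 using unit far by eventually_elim auto
  ultimately obtain t y' where t[measurable]: "t \<in> borel_measurable M" and t0: "\<And>\<omega>. 0 \<le> t \<omega>" and t1: "\<And>\<omega>. t \<omega> \<le> 1"
    and y'_eq: "y' = rv_class M (\<lambda>\<omega>. 1 / nrm (bent_path x y t) \<omega>) \<odot> bent_path x y t"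
    and y'_props: "AE \<omega> in M. \<omega> \<in> D \<longrightarrow> nrm y' \<omega> = 1 \<and> nrm (x \<ominus> y') \<omega> = \<epsilon> \<omega>"
    using bent_path_hits_sphere[OF xy unit \<epsilon> _ zero_le_one bent_path_pos] by blast
  define N where "N = nrm (bent_path x y t)"
  have [measurable]: "N \<in> borel_measurable M" unfolding N_def using xy by auto
  define a where "a \<omega> = (1 - t \<omega>) / N \<omega>" for \<omega>
  define b where "b \<omega> = t \<omega> / N \<omega>" for \<omega>
  have [measurable]: "a \<in> borel_measurable M" "b \<in> borel_measurable M"
    unfolding a_def b_def by measurable
  have y'_ab: "y' = comb a x b y"
    using smult_comb[of "\<lambda>\<omega>. 1 / N \<omega>" "\<lambda>\<omega>. 1 - t \<omega>" t x y] xy t0 t1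
    unfolding y'_eq N_def[symmetric] by (simp add: bent_path_def a_def[abs_def] b_def[abs_def])
  have y': "y' \<in> carrier S" unfolding y'_ab using xy by auto
  have sum_eq: "x \<oplus> y' = comb (\<lambda>\<omega>. 1 + a \<omega>) x b y"
    using comb_add[of "\<lambda>_. 1" "\<lambda>_. 0" a b x y] xy by (simp add: y'_ab comb_basis)
  have diff_eq: "x \<ominus> y' = comb (\<lambda>\<omega>. 1 - a \<omega>) x (\<lambda>\<omega>. - b \<omega>) y"
    using comb_comb[of "\<lambda>_. 1" "\<lambda>_. -1" "\<lambda>_. 1" "\<lambda>_. 0" a b x y] xy y'
    by (simp add: y'_ab[symmetric] comb_basis)
  have N_pos: "AE \<omega> in M. \<omega> \<in> D \<longrightarrow> 0 < N \<omega>"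
    unfolding N_def using t0 t1 by (intro bent_path_pos) auto
  have A: "AE \<omega> in M. \<bar>b \<omega> * (1 + a \<omega>)\<bar> * nrm (comb (\<lambda>_. 1) x (\<lambda>_. 1) y) \<omega> \<le>
      \<bar>(1 + a \<omega> - b \<omega>) * b \<omega>\<bar> * nrm (comb (\<lambda>_. 0) x (\<lambda>_. 1) y) \<omega> + \<bar>b \<omega>\<bar> * nrm (x \<oplus> y') \<omega>"
    unfolding sum_eq using xy by (intro nrm_comb_le) (auto simp: algebra_simps)
  have B: "AE \<omega> in M. \<bar>1 + a \<omega>\<bar> * nrm (comb a x b y) \<omega> \<le>
      \<bar>a \<omega>\<bar> * nrm (x \<oplus> y') \<omega> + \<bar>b \<omega>\<bar> * nrm (comb (\<lambda>_. 0) x (\<lambda>_. 1) y) \<omega>"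
    unfolding sum_eq using xy by (intro nrm_comb_le) (auto simp: algebra_simps)
  have C: "AE \<omega> in M. \<bar>b \<omega>\<bar> * nrm (comb (\<lambda>_. 0) x (\<lambda>_. 1) y) \<omega> \<le>
      \<bar>1\<bar> * nrm (comb a x b y) \<omega> + \<bar>- a \<omega>\<bar> * nrm (comb (\<lambda>_. 1) x (\<lambda>_. 0) y) \<omega>"
    using xy by (intro nrm_comb_le) auto
  have E: "AE \<omega> in M. \<bar>1\<bar> * nrm (x \<ominus> y') \<omega> \<le>
      \<bar>1 - a \<omega>\<bar> * nrm (comb (\<lambda>_. 1) x (\<lambda>_. 0) y) \<omega> + \<bar>- b \<omega>\<bar> * nrm (comb (\<lambda>_. 0) x (\<lambda>_. 1) y) \<omega>"
    unfolding diff_eq using xy by (intro nrm_comb_le) auto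
  have E1: "AE \<omega> in M. \<bar>1\<bar> * nrm (comb a x b y) \<omega> \<le>
      \<bar>a \<omega>\<bar> * nrm (comb (\<lambda>_. 1) x (\<lambda>_. 0) y) \<omega> + \<bar>b \<omega>\<bar> * nrm (comb (\<lambda>_. 0) x (\<lambda>_. 1) y) \<omega>"
    using xy by (intro nrm_comb_le) auto
  have E2: "AE \<omega> in M. \<bar>a \<omega>\<bar> * nrm (comb (\<lambda>_. 1) x (\<lambda>_. 0) y) \<omega> \<le>
      \<bar>1\<bar> * nrm (comb a x b y) \<omega> + \<bar>- b \<omega>\<bar> * nrm (comb (\<lambda>_. 0) x (\<lambda>_. 1) y) \<omega>"
    using xy by (intro nrm_comb_le) auto
  have "AE \<omega> in M. \<omega> \<in> D \<longrightarrow> nrm y' \<omega> = 1 \<and>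
    nrm (x \<ominus> y') \<omega> = \<epsilon> \<omega> \<and> nrm (x \<oplus> y) \<omega> \<le> nrm (x \<oplus> y') \<omega>"
    using A B C E E1 E2 y'_props N_pos unit \<epsilon>_range
  proof eventually_elim
    case (elim \<omega>)
    show ?case
    proof
      assume D: "\<omega> \<in> D"
      note e = elim[folded y'_ab, simplified comb_basis[OF xy]]
      have a: "0 \<le> a \<omega>" and b: "0 \<le> b \<omega>"
        using t0[of \<omega>] t1[of \<omega>] e D by (auto simp: a_def b_def)
      \<comment> \<open>If \<open>b = 0\<close> then \<open>y' = x\<close>, which is excluded by \<open>\<epsilon> > 0\<close>.\<close>
      have b_pos: "0 < b \<omega>"
      proof (rule ccontr)
        assume "\<not> 0 < b \<omega>"
        then have "b \<omega> = 0" using b by simp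
        moreover from this have "a \<omega> = 1" using e D a by auto
        ultimately show False using e D by auto
      qed
      define Q where "Q = nrm (x \<oplus> y) \<omega>"
      define h where "h = nrm (x \<oplus> y') \<omega>"
      have bd: "b \<omega> \<le> 1 + a \<omega>" using e D a b by auto
      have lo: "1 + a \<omega> - b \<omega> \<le> a \<omega> * h" using e D a b by (auto simp: h_def)
      have "b \<omega> * ((1 + a \<omega>) * Q) \<le> b \<omega> * ((1 + a \<omega> - b \<omega>) + h)"
      proof -
        have "\<bar>b \<omega> * (1 + a \<omega>)\<bar> = b \<omega> * (1 + a \<omega>)" "\<bar>(1 + a \<omega> - b \<omega>) * b \<omega>\<bar> = (1 + a \<omega> - b \<omega>) * b \<omega>"
          using a b bd by simp_all
        then have "b \<omega> * (1 + a \<omega>) * Q \<le> (1 + a \<omega> - b \<omega>) * b \<omega> * 1 + b \<omega> * h"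
          using e D b by (simp add: Q_def h_def)
        then show ?thesis by (simp add: algebra_simps)
      qed
      then have "(1 + a \<omega>) * Q \<le> (1 + a \<omega> - b \<omega>) + h" using b_pos by simp
      also have "\<dots> \<le> (1 + a \<omega>) * h" using lo by (simp add: algebra_simps)
      finally have "Q \<le> h" using a by simp
      then show "nrm y' \<omega> = 1 \<and> nrm (x \<ominus> y') \<omega> = \<epsilon> \<omega> \<and> nrm (x \<oplus> y) \<omega> \<le> nrm (x \<oplus> y') \<omega>"
        using e D by (simp add: Q_def h_def)
    qed
  qed
  then show thesis using that y' by blast
qed

section \<open>Pasting\<close>

lemma comb_add_vectors:
  assumes "f \<in> borel_measurable M" "g \<in> borel_measurable M"
    and "x \<in> carrier S" "y \<in> carrier S" "x' \<in> carrier S" "y' \<in> carrier S"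
  shows "comb f x g y \<oplus> comb f x' g y' = comb f (x \<oplus> x') g (y \<oplus> y')"
  using assms by (simp add: comb_def smult_r_distr M.a_ac)

lemma comb_diff_vectors:
  assumes "f \<in> borel_measurable M" "g \<in> borel_measurable M"
    and "x \<in> carrier S" "y \<in> carrier S" "x' \<in> carrier S" "y' \<in> carrier S"
  shows "comb f x g y \<ominus> comb f x' g y' = comb f (x \<ominus> x') g (y \<ominus> y')"
  using assms by (simp add: comb_def smult_r_distr smult_r_minus M.minus_eq M.minus_add M.a_ac)

lemma comb_same:
  assumes [measurable]: "f \<in> borel_measurable M" and "x \<in> carrier S"
  shows "comb f x (\<lambda>\<omega>. 1 - f \<omega>) x = x"
  using assms by (simp add: comb_def smult_add smult_1)

lemma nrm_diff_le:
  assumes "x \<in> carrier S" "y \<in> carrier S"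
  shows "AE \<omega> in M. \<bar>nrm x \<omega> - nrm y \<omega>\<bar> \<le> nrm (x \<ominus> y) \<omega>"
proof -
  have "AE \<omega> in M. \<bar>1\<bar> * nrm (comb (\<lambda>_. 1) x (\<lambda>_. 0) y) \<omega> \<le>
      \<bar>1\<bar> * nrm (comb (\<lambda>_. 0) x (\<lambda>_. 1) y) \<omega> + \<bar>1\<bar> * nrm (comb (\<lambda>_. 1) x (\<lambda>_. -1) y) \<omega>"
    using assms by (intro nrm_comb_le) auto
  moreover have "AE \<omega> in M. \<bar>1\<bar> * nrm (comb (\<lambda>_. 0) x (\<lambda>_. 1) y) \<omega> \<le>
      \<bar>1\<bar> * nrm (comb (\<lambda>_. 1) x (\<lambda>_. 0) y) \<omega> + \<bar>-1\<bar> * nrm (comb (\<lambda>_. 1) x (\<lambda>_. -1) y) \<omega>"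
    using assms by (intro nrm_comb_le) auto
  ultimately show ?thesis by eventually_elim (simp add: comb_basis assms)
qed

lemma nrm_minus_triangle:
  assumes "x \<in> carrier S" "y \<in> carrier S" "z \<in> carrier S"
  shows "AE \<omega> in M. nrm (x \<ominus> z) \<omega> \<le> nrm (x \<ominus> y) \<omega> + nrm (y \<ominus> z) \<omega>"
proof -
  have "(x \<ominus> y) \<oplus> (y \<ominus> z) = x \<ominus> z"
    using assms by (simp add: M.minus_eq M.a_assoc M.r_neg1)
  then show ?thesis using nrm_add_le[of "x \<ominus> y" "y \<ominus> z"] assms by simp
qed

lemma nrm_minus_self: "x \<in> carrier S \<Longrightarrow> AE \<omega> in M. nrm (x \<ominus> x) \<omega> = 0"
  using nrm_comb_scale[of "\<lambda>_. 0" "\<lambda>_. 0" "\<lambda>_. 0" x x]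
  by (simp add: comb_def smult_0 M.minus_eq M.r_neg)

definition patch :: "'w set \<Rightarrow> 's \<Rightarrow> 's \<Rightarrow> 's" where
  "patch E x y = comb (indicator E) x (\<lambda>\<omega>. 1 - indicator E \<omega>) y"

lemma patch_closed [simp, intro]:
  "\<lbrakk>E \<in> sets M; x \<in> carrier S; y \<in> carrier S\<rbrakk> \<Longrightarrow> patch E x y \<in> carrier S"
  unfolding patch_def by auto

lemma nrm_patch:
  assumes [measurable]: "E \<in> sets M" and xy: "x \<in> carrier S" "y \<in> carrier S"
  shows "AE \<omega> in M. nrm (patch E x y) \<omega> = (if \<omega> \<in> E then nrm x \<omega> else nrm y \<omega>)"
proof -
  have "AE \<omega> in M. \<bar>nrm (patch E x y) \<omega> - nrm (comb (\<lambda>_. 1) x (\<lambda>_. 0) y) \<omega>\<bar>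
      \<le> \<bar>indicator E \<omega> - 1\<bar> * nrm x \<omega> + \<bar>(1 - indicator E \<omega>) - 0\<bar> * nrm y \<omega>"
    unfolding patch_def using xy by (intro nrm_comb_lipschitz) auto
  moreover have "AE \<omega> in M. \<bar>nrm (patch E x y) \<omega> - nrm (comb (\<lambda>_. 0) x (\<lambda>_. 1) y) \<omega>\<bar>
      \<le> \<bar>indicator E \<omega> - 0\<bar> * nrm x \<omega> + \<bar>(1 - indicator E \<omega>) - 1\<bar> * nrm y \<omega>"
    unfolding patch_def using xy by (intro nrm_comb_lipschitz) auto
  ultimately show ?thesis by eventually_elim (auto simp: comb_basis xy)
qed

lemma patch_plus:
  "\<lbrakk>E \<in> sets M; x \<in> carrier S; y \<in> carrier S; x' \<in> carrier S; y' \<in> carrier S\<rbrakk> \<Longrightarrow>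
    patch E x y \<oplus> patch E x' y' = patch E (x \<oplus> x') (y \<oplus> y')"
  by (simp add: patch_def comb_add_vectors)

lemma patch_minus:
  "\<lbrakk>E \<in> sets M; x \<in> carrier S; y \<in> carrier S; x' \<in> carrier S; y' \<in> carrier S\<rbrakk> \<Longrightarrow>
    patch E x y \<ominus> patch E x' y' = patch E (x \<ominus> x') (y \<ominus> y')"
  by (simp add: patch_def comb_diff_vectors)

lemma patch_minus_left:
  assumes "E \<in> sets M" "x \<in> carrier S" "y \<in> carrier S" "z \<in> carrier S"
  shows "patch E x y \<ominus> z = patch E (x \<ominus> z) (y \<ominus> z)"
  using patch_minus[of E x y z z] comb_same[of "indicator E" z] assms by (simp add: patch_def)

text \<open>The partial pastings change on \<open>F n\<close> only in step \<open>n\<close>, so two late ones differ at most on a tail of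
  the disjoint sequence, whose probability tends to zero. Hence they form a Cauchy sequence in
  probability. On each \<open>F k\<close> they are eventually equal to \<open>X k\<close>, and so is the limit.\<close>

lemma countable_pasting:
  assumes complete: "rn_complete M S"
    and F: "\<And>n. F n \<in> sets M" "disjoint_family F"
    and X: "\<And>n::nat. X n \<in> carrier S"
  obtains x where "x \<in> carrier S" "\<And>n. AE \<omega> in M. \<omega> \<in> F n \<longrightarrow> nrm (x \<ominus> X n) \<omega> = 0"
proof -
  define s where "s = rec_nat \<zero> (\<lambda>n a. patch (F n) (X n) a)"
  have s_Suc: "s (Suc n) = patch (F n) (X n) (s n)" for n by (simp add: s_def)
  have s: "s n \<in> carrier S" for n
    by (induction n) (use F X in \<open>auto simp: s_Suc, auto simp: s_def\<close>)
  note [measurable] = F(1)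
  have on: "AE \<omega> in M. \<omega> \<in> F n \<longrightarrow> nrm (s (Suc n) \<ominus> X n) \<omega> = 0" for n
    using nrm_patch[of "F n" "X n \<ominus> X n" "s n \<ominus> X n"] nrm_minus_self[OF X[of n]] F X s
    by (auto simp: s_Suc patch_minus_left elim!: eventually_elim2)
  have off: "AE \<omega> in M. \<omega> \<notin> F n \<longrightarrow> nrm (s (Suc n) \<ominus> s n) \<omega> = 0" for n
    using nrm_patch[of "F n" "X n \<ominus> s n" "s n \<ominus> s n"] nrm_minus_self[OF s[of n]] F X s
    by (auto simp: s_Suc patch_minus_left elim!: eventually_elim2)
  have stable: "AE \<omega> in M. \<omega> \<notin> (\<Union>k\<in>{n..}. F k) \<longrightarrow> nrm (s m \<ominus> s n) \<omega> = 0" if "n \<le> m" for n m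
    using that
  proof (induction m rule: dec_induct)
    case base
    then show ?case using nrm_minus_self[OF s[of n]] by auto
  next
    case (step m)
    have "AE \<omega> in M. 0 \<le> nrm (s (Suc m) \<ominus> s n) \<omega>" using s by (intro nrm_nonneg) auto
    then show ?case using step.IH off[of m] nrm_minus_triangle[OF s[of "Suc m"] s[of m] s[of n]]
    proof eventually_elim
      case (elim \<omega>)
      then show ?case using \<open>n \<le> m\<close> by fastforce
    qed
  qed
  have keep: "AE \<omega> in M. \<omega> \<in> F k \<longrightarrow> nrm (s n \<ominus> X k) \<omega> = 0" if "k < n" for n k
    using Suc_leI[OF that]
  proof (induction n rule: dec_induct)
    case base
    then show ?case by (rule on)
  next
    case (step n)
    have disj: "F k \<inter> F n = {}" using F(2) step.hyps by (auto simp: disjoint_family_on_def)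
    have "AE \<omega> in M. 0 \<le> nrm (s (Suc n) \<ominus> X k) \<omega>" using s X by (intro nrm_nonneg) auto
    then show ?case using step.IH off[of n] nrm_minus_triangle[OF s[of "Suc n"] s[of n] X[of k]]
    proof eventually_elim
      case (elim \<omega>)
      then show ?case using disj by fastforce
    qed
  qed
  define U where "U n = (\<Union>k\<in>{n..}. F k)" for n
  have U[measurable]: "U n \<in> sets M" for n unfolding U_def by auto
  have "(\<lambda>n. prob (U n)) \<longlonglongrightarrow> prob (\<Inter>n. U n)"
    by (rule finite_Lim_measure_decseq) (auto simp: decseq_def U_def intro: order_trans)
  also have "(\<Inter>n. U n) = {}"
  proof -
    have False if in_U: "\<And>n. \<omega> \<in> U n" for \<omega>
    proof -
      obtain k where k: "\<omega> \<in> F k" using in_U[of 0] unfolding U_def by blast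
      obtain j where "\<omega> \<in> F j" "j \<ge> Suc k" using in_U[of "Suc k"] unfolding U_def by blast
      moreover from this have "F k \<inter> F j = {}" using F(2) by (auto simp: disjoint_family_on_def)
      ultimately show False using k by blast
    qed
    then show ?thesis by auto
  qed
  finally have U_lim: "(\<lambda>n. prob (U n)) \<longlonglongrightarrow> 0" by simp
  have "rn_Cauchy M S s"
    unfolding rn_Cauchy_def
  proof (intro allI impI)
    fix e r :: real assume "e > 0" "r > 0"
    then obtain N where N: "prob (U N) < r"
      using order_tendstoD(2)[OF U_lim, of r] by (auto simp: eventually_sequentially)
    have 1: "AE \<omega> in M. \<omega> \<notin> U N \<longrightarrow> nrm (s m \<ominus> s N) \<omega> = 0" if "m \<ge> N" for m
      using stable[OF that] by (simp add: U_def)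
    have "prob_gt M \<parallel>s m \<ominus> s n\<parallel> e < r" if "m \<ge> N" "n \<ge> N" for m n
    proof -
      have [measurable]: "nrm (s m \<ominus> s n) \<in> borel_measurable M" using s by auto
      have "prob {\<omega> \<in> space M. nrm (s m \<ominus> s n) \<omega> > e} \<le> prob (U N)"
      proof (rule finite_measure_mono_AE)
        show "AE \<omega> in M. \<omega> \<in> {\<omega> \<in> space M. nrm (s m \<ominus> s n) \<omega> > e} \<longrightarrow> \<omega> \<in> U N"
          using 1[OF that(1)] 1[OF that(2)] nrm_minus_triangle[OF s[of m] s[of N] s[of n]]
            nrm_minus_commute[OF s[of N] s[of n]]
          by eventually_elim (use \<open>e > 0\<close> in force)
      qed auto
      then show ?thesis using N by (simp add: prob_gt_def nrm_def)
    qed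
    then show "\<exists>N. \<forall>m\<ge>N. \<forall>n\<ge>N. prob_gt M \<parallel>s m \<ominus> s n\<parallel> e < r" by blast
  qed
  then obtain l where l: "l \<in> carrier S" and lim: "rn_tendsto M S s l"
    using complete s unfolding rn_complete_def by blast
  have "AE \<omega> in M. \<omega> \<in> F k \<longrightarrow> nrm (l \<ominus> X k) \<omega> = 0" for k
  proof -
    have [measurable]: "nrm (l \<ominus> X k) \<in> borel_measurable M" using l X by auto
    have "AE \<omega> in M. \<omega> \<notin> {\<omega> \<in> F k. nrm (l \<ominus> X k) \<omega> > 1 / real (Suc j)}" for j
    proof -
      let ?e = "1 / real (Suc j)"
      have meas[measurable]: "{\<omega> \<in> F k. nrm (l \<ominus> X k) \<omega> > ?e} \<in> sets M"
        using F(1)[of k] by simp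
      have "(\<lambda>n. prob_gt M \<parallel>s n \<ominus> l\<parallel> ?e) \<longlonglongrightarrow> 0"
        using lim by (simp add: rn_tendsto_def)
      moreover have "prob {\<omega> \<in> F k. nrm (l \<ominus> X k) \<omega> > ?e} \<le> prob_gt M \<parallel>s n \<ominus> l\<parallel> ?e" if "n > k" for n
      proof -
        have [measurable]: "nrm (s n \<ominus> l) \<in> borel_measurable M" using s l by auto
        have "prob {\<omega> \<in> F k. nrm (l \<ominus> X k) \<omega> > ?e} \<le> prob {\<omega> \<in> space M. nrm (s n \<ominus> l) \<omega> > ?e}"
        proof (rule finite_measure_mono_AE)
          show "AE \<omega> in M. \<omega> \<in> {\<omega> \<in> F k. nrm (l \<ominus> X k) \<omega> > ?e} \<longrightarrow> \<omega> \<in> {\<omega> \<in> space M. nrm (s n \<ominus> l) \<omega> > ?e}"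
            using keep[OF that] nrm_minus_triangle[OF l s[of n] X[of k]]
              nrm_minus_commute[OF l s[of n]] AE_space
            by eventually_elim auto
        qed auto
        then show ?thesis by (simp add: prob_gt_def nrm_def)
      qed
      ultimately have "prob {\<omega> \<in> F k. nrm (l \<ominus> X k) \<omega> > ?e} \<le> 0"
        by (intro LIMSEQ_le_const[of _ 0]) (auto intro: exI[of _ "Suc k"])
      then have "prob {\<omega> \<in> F k. nrm (l \<ominus> X k) \<omega> > ?e} = 0"
        by (simp add: measure_le_0_iff)
      then show ?thesis using prob_eq_0[OF meas] by simp
    qed
    then have "AE \<omega> in M. \<forall>j. \<omega> \<notin> {\<omega> \<in> F k. nrm (l \<ominus> X k) \<omega> > 1 / real (Suc j)}"
      unfolding AE_all_countable by blast
    moreover have "AE \<omega> in M. 0 \<le> nrm (l \<ominus> X k) \<omega>" using l X by (intro nrm_nonneg) auto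
    ultimately show ?thesis
    proof eventually_elim
      case (elim \<omega>)
      show ?case
      proof (rule impI, rule ccontr)
        assume "\<omega> \<in> F k" "nrm (l \<ominus> X k) \<omega> \<noteq> 0"
        then obtain j where "inverse (real (Suc j)) < nrm (l \<ominus> X k) \<omega>"
          using elim(2) reals_Archimedean[of "nrm (l \<ominus> X k) \<omega>"] by auto
        then show False using elim(1) \<open>\<omega> \<in> F k\<close> by (auto simp: inverse_eq_divide)
      qed
    qed
  qed
  then show thesis using that l by blast
qed

section \<open>Rank at least two on an event\<close>

text \<open>\<open>L\<^sup>0\<close>-independence in pointwise form. Unlike the definition with annihilated products, it is
  visibly inherited by subsets and by countable unions.\<close>

definition independent_on :: "'w set \<Rightarrow> 's \<Rightarrow> 's \<Rightarrow> bool" where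
  "independent_on F x y \<longleftrightarrow> (\<forall>f\<in>borel_measurable M. \<forall>g\<in>borel_measurable M.
    AE \<omega> in M. \<omega> \<in> F \<and> nrm (comb f x g y) \<omega> = 0 \<longrightarrow> f \<omega> = 0 \<and> g \<omega> = 0)"

definition two_dimensional_on :: "'w set \<Rightarrow> bool" where
  "two_dimensional_on F \<longleftrightarrow> (\<exists>x\<in>carrier S. \<exists>y\<in>carrier S. independent_on F x y)"

text \<open>If a random combination vanishes in norm on a part \<open>K\<close> of \<open>F\<close> only, then its product with the
  indicator of \<open>K\<close> is the null vector, to which the algebraic notion applies.\<close>

lemma L0_indep_on_iff:
  assumes F: "F \<in> Ev M" and xy: "x \<in> carrier S" "y \<in> carrier S"
  shows "L0_indep_on M S F x y \<longleftrightarrow> independent_on (rep F) x y"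
proof -
  have [measurable]: "rep F \<in> sets M" using rep_Ev(1)[OF F] .
  have mult: "rv_class M f \<otimes>\<^bsub>L0 M\<^esub> L0_ind M F = rv_class M (\<lambda>\<omega>. f \<omega> * indicator (rep F) \<omega>)"
    if "f \<in> borel_measurable M" for f
    unfolding L0_ind_def using that by (intro rv_class_mult) auto
  have L0_zero: "rv_class M f = \<zero>\<^bsub>L0 M\<^esub> \<longleftrightarrow> (AE \<omega> in M. f \<omega> = 0)" if "f \<in> borel_measurable M" for f
  proof
    assume "rv_class M f = \<zero>\<^bsub>L0 M\<^esub>"
    then have "f \<in> rv_class M (\<lambda>_. 0)" using that by (auto simp: L0_def rv_class_def)
    then show "AE \<omega> in M. f \<omega> = 0" by (simp add: rv_class_def)
  next
    assume "AE \<omega> in M. f \<omega> = 0"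
    then show "rv_class M f = \<zero>\<^bsub>L0 M\<^esub>" using rv_class_cong[of f "\<lambda>_. 0" M] by (simp add: L0_def)
  qed
  have L0_indep: "L0_indep_on M S F x y \<longleftrightarrow> (\<forall>f\<in>borel_measurable M. \<forall>g\<in>borel_measurable M.
      comb (\<lambda>\<omega>. f \<omega> * indicator (rep F) \<omega>) x (\<lambda>\<omega>. g \<omega> * indicator (rep F) \<omega>) y = \<zero> \<longrightarrow>
      (AE \<omega> in M. f \<omega> * indicator (rep F) \<omega> = 0) \<and> (AE \<omega> in M. g \<omega> * indicator (rep F) \<omega> = 0))"
  proof -
    have carrier: "carrier (L0 M) = rv_class M ` borel_measurable M" by (simp add: L0_def RV_def)
    have "(rv_class M f \<otimes>\<^bsub>L0 M\<^esub> L0_ind M F) \<odot> x \<oplus> (rv_class M g \<otimes>\<^bsub>L0 M\<^esub> L0_ind M F) \<odot> y =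
        comb (\<lambda>\<omega>. f \<omega> * indicator (rep F) \<omega>) x (\<lambda>\<omega>. g \<omega> * indicator (rep F) \<omega>) y"
      if "f \<in> borel_measurable M" "g \<in> borel_measurable M" for f g
      using that by (simp add: mult comb_def)
    moreover have "rv_class M f \<otimes>\<^bsub>L0 M\<^esub> L0_ind M F = \<zero>\<^bsub>L0 M\<^esub> \<longleftrightarrow> (AE \<omega> in M. f \<omega> * indicator (rep F) \<omega> = 0)"
      if [measurable]: "f \<in> borel_measurable M" for f
      unfolding mult[OF that] by (intro L0_zero) auto
    ultimately show ?thesis unfolding L0_indep_on_def carrier Set.ball_simps(9) by (intro ball_cong refl) simp
  qed
  show ?thesis
  proof
    assume L: "L0_indep_on M S F x y"
    show "independent_on (rep F) x y"
      unfolding independent_on_def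
    proof (intro ballI)
      fix f g :: "'w \<Rightarrow> real"
      assume fg[measurable]: "f \<in> borel_measurable M" "g \<in> borel_measurable M"
      define K where "K = {\<omega> \<in> rep F. nrm (comb f x g y) \<omega> = 0}"
      have [measurable]: "nrm (comb f x g y) \<in> borel_measurable M" using xy by auto
      have [measurable]: "K \<in> sets M" unfolding K_def by measurable
      \<comment> \<open>\<open>K\<close> lies in \<open>F\<close>, so cutting down to \<open>F\<close> after \<open>K\<close> has no effect.\<close>
      have K: "indicator K \<omega> * h * indicator (rep F) \<omega> = indicator K \<omega> * (h::real)" for \<omega> h
        by (auto simp: K_def indicator_def)
      have "AE \<omega> in M. nrm (comb (\<lambda>\<omega>. indicator K \<omega> * f \<omega>) x (\<lambda>\<omega>. indicator K \<omega> * g \<omega>) y) \<omega> = 0"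
        using nrm_comb_scale[of "indicator K" f g x y] xy
        by (auto simp: K_def indicator_def elim!: eventually_mono)
      then have "comb (\<lambda>\<omega>. indicator K \<omega> * f \<omega>) x (\<lambda>\<omega>. indicator K \<omega> * g \<omega>) y = \<zero>"
        using xy by (intro nrm_eq_0 comb_closed) auto
      then have "AE \<omega> in M. indicator K \<omega> * f \<omega> = 0" "AE \<omega> in M. indicator K \<omega> * g \<omega> = 0"
        using L[unfolded L0_indep, rule_format, of "\<lambda>\<omega>. indicator K \<omega> * f \<omega>" "\<lambda>\<omega>. indicator K \<omega> * g \<omega>"]
        by (simp_all add: K)
      then show "AE \<omega> in M. \<omega> \<in> rep F \<and> nrm (comb f x g y) \<omega> = 0 \<longrightarrow> f \<omega> = 0 \<and> g \<omega> = 0"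
        by eventually_elim (auto simp: K_def)
    qed
  next
    assume ind: "independent_on (rep F) x y"
    show "L0_indep_on M S F x y"
      unfolding L0_indep
    proof (intro ballI impI)
      fix f g :: "'w \<Rightarrow> real"
      let ?f = "\<lambda>\<omega>. f \<omega> * indicator (rep F) \<omega>" and ?g = "\<lambda>\<omega>. g \<omega> * indicator (rep F) \<omega>"
      assume fg[measurable]: "f \<in> borel_measurable M" "g \<in> borel_measurable M"
        and z: "comb ?f x ?g y = \<zero>"
      have "AE \<omega> in M. nrm \<zero> \<omega> = 0"
        using nrm_minus_self[of x] xy by (simp add: M.minus_eq M.r_neg)
      moreover have "AE \<omega> in M. \<omega> \<in> rep F \<and> nrm (comb ?f x ?g y) \<omega> = 0 \<longrightarrow> ?f \<omega> = 0 \<and> ?g \<omega> = 0"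
        using ind[unfolded independent_on_def, rule_format, of ?f ?g] by simp
      ultimately have "AE \<omega> in M. ?f \<omega> = 0 \<and> ?g \<omega> = 0"
        unfolding z by eventually_elim auto
      then show "(AE \<omega> in M. ?f \<omega> = 0) \<and> (AE \<omega> in M. ?g \<omega> = 0)" by simp
    qed
  qed
qed

lemma rank_ge2_iff: "F \<in> Ev M \<Longrightarrow> rank_ge2 M S F \<longleftrightarrow> two_dimensional_on (rep F)"
  by (auto simp: rank_ge2_def two_dimensional_on_def L0_indep_on_iff)

lemma independent_on_mono:
  assumes "independent_on F x y" "AE \<omega> in M. \<omega> \<in> E \<longrightarrow> \<omega> \<in> F"
  shows "independent_on E x y"
  unfolding independent_on_def
proof (intro ballI)
  fix f g :: "'w \<Rightarrow> real"
  assume "f \<in> borel_measurable M" "g \<in> borel_measurable M"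
  then have "AE \<omega> in M. \<omega> \<in> F \<and> nrm (comb f x g y) \<omega> = 0 \<longrightarrow> f \<omega> = 0 \<and> g \<omega> = 0"
    using assms(1) by (simp add: independent_on_def)
  then show "AE \<omega> in M. \<omega> \<in> E \<and> nrm (comb f x g y) \<omega> = 0 \<longrightarrow> f \<omega> = 0 \<and> g \<omega> = 0"
    using assms(2) by eventually_elim auto
qed

lemma two_dimensional_on_mono:
  "\<lbrakk>two_dimensional_on F; AE \<omega> in M. \<omega> \<in> E \<longrightarrow> \<omega> \<in> F\<rbrakk> \<Longrightarrow> two_dimensional_on E"
  unfolding two_dimensional_on_def using independent_on_mono by blast

lemma two_dimensional_on_UN:
  assumes complete: "rn_complete M S"
    and F: "\<And>n::nat. F n \<in> sets M" "\<And>n. two_dimensional_on (F n)"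
  shows "two_dimensional_on (\<Union>n. F n)"
proof -
  have d_meas: "disjointed F n \<in> sets M" for n using sets.range_disjointed_sets'[of F] F(1) by blast
  have "two_dimensional_on (disjointed F n)" for n
    using F(2)[of n] disjointed_subset[of F n] by (elim two_dimensional_on_mono) auto
  then obtain X Y where X: "\<And>n. X n \<in> carrier S" and Y: "\<And>n. Y n \<in> carrier S"
    and ind: "\<And>n. independent_on (disjointed F n) (X n) (Y n)"
    unfolding two_dimensional_on_def by metis
  obtain x where x: "x \<in> carrier S" "\<And>n. AE \<omega> in M. \<omega> \<in> disjointed F n \<longrightarrow> nrm (x \<ominus> X n) \<omega> = 0"
    using countable_pasting[where F="disjointed F" and X=X, OF complete d_meas disjoint_family_disjointed X] by blast
  obtain y where y: "y \<in> carrier S" "\<And>n. AE \<omega> in M. \<omega> \<in> disjointed F n \<longrightarrow> nrm (y \<ominus> Y n) \<omega> = 0"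
    using countable_pasting[where F="disjointed F" and X=Y, OF complete d_meas disjoint_family_disjointed Y] by blast
  have "independent_on (\<Union>n. disjointed F n) x y"
    unfolding independent_on_def
  proof (intro ballI)
    fix f g :: "'w \<Rightarrow> real"
    assume fg[measurable]: "f \<in> borel_measurable M" "g \<in> borel_measurable M"
    have "AE \<omega> in M. \<omega> \<in> disjointed F n \<and> nrm (comb f x g y) \<omega> = 0 \<longrightarrow> f \<omega> = 0 \<and> g \<omega> = 0" for n
    proof -
      have "AE \<omega> in M. \<omega> \<in> disjointed F n \<and> nrm (comb f (X n) g (Y n)) \<omega> = 0 \<longrightarrow> f \<omega> = 0 \<and> g \<omega> = 0"
        using ind[of n] fg by (simp add: independent_on_def)
      moreover have "AE \<omega> in M. \<bar>nrm (comb f x g y) \<omega> - nrm (comb f (X n) g (Y n)) \<omega>\<bar>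
          \<le> nrm (comb f (x \<ominus> X n) g (y \<ominus> Y n)) \<omega>"
        using nrm_diff_le[of "comb f x g y" "comb f (X n) g (Y n)"] x(1) y(1) X Y
        by (simp add: comb_diff_vectors)
      moreover have "AE \<omega> in M. \<bar>1\<bar> * nrm (comb f (x \<ominus> X n) g (y \<ominus> Y n)) \<omega> \<le>
          \<bar>f \<omega>\<bar> * nrm (comb (\<lambda>_. 1) (x \<ominus> X n) (\<lambda>_. 0) (y \<ominus> Y n)) \<omega>
          + \<bar>g \<omega>\<bar> * nrm (comb (\<lambda>_. 0) (x \<ominus> X n) (\<lambda>_. 1) (y \<ominus> Y n)) \<omega>"
        using x(1) y(1) X Y by (intro nrm_comb_le) auto
      ultimately show ?thesis using x(2)[of n] y(2)[of n]
        by eventually_elim (auto simp: comb_basis x(1) y(1) X Y)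
    qed
    then have "AE \<omega> in M. \<forall>n. \<omega> \<in> disjointed F n \<and> nrm (comb f x g y) \<omega> = 0 \<longrightarrow> f \<omega> = 0 \<and> g \<omega> = 0"
      unfolding AE_all_countable by blast
    then show "AE \<omega> in M. \<omega> \<in> (\<Union>n. disjointed F n) \<and> nrm (comb f x g y) \<omega> = 0 \<longrightarrow> f \<omega> = 0 \<and> g \<omega> = 0"
      by eventually_elim auto
  qed
  then show ?thesis using x(1) y(1) by (auto simp: two_dimensional_on_def UN_disjointed_eq)
qed

section \<open>The events H(S) and G(S)\<close>

text \<open>Since \<open>S\<close> is closed under multiplication by scalars, the essential supremum of all norms
  is \<open>\<infinity>\<close> on a largest countable union \<open>E\<close> of supports \<open>[\<parallel>x\<parallel> > 0]\<close> and \<open>0\<close> elsewhere. In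
  particular the supremum exists, so its chosen representative is measurable and \<open>H(S)\<close> is an event.\<close>

lemma H_of_measurable: "rep (H_of M S) \<in> sets M"
proof -
  define A where "A x = {\<omega> \<in> space M. 0 < nrm x \<omega>}" for x
  have A[measurable]: "A x \<in> sets M" if "x \<in> carrier S" for x
    unfolding A_def using nrm_measurable[OF that] by measurable
  define C where "C = {\<Union>n::nat. A (X n) |X. range X \<subseteq> carrier S}"
  obtain E where E: "E \<in> C" and E_max: "\<And>F. F \<in> C \<Longrightarrow> AE \<omega> in M. \<omega> \<in> F \<longrightarrow> \<omega> \<in> E"
  proof (rule exhaustion[of C])
    show "C \<subseteq> sets M" unfolding C_def by (force intro: sets.countable_UN A)
    show "C \<noteq> {}" unfolding C_def by (auto intro: exI[of _ "\<lambda>_. \<zero>"])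
    show "(\<Union>n. B n) \<in> C" if "range B \<subseteq> C" for B :: "nat \<Rightarrow> 'w set"
    proof -
      have "\<forall>n. \<exists>X::nat \<Rightarrow> 's. range X \<subseteq> carrier S \<and> B n = (\<Union>k. A (X k))"
      proof
        fix n
        have "B n \<in> C" using that by auto
        then show "\<exists>X::nat \<Rightarrow> 's. range X \<subseteq> carrier S \<and> B n = (\<Union>k. A (X k))"
          unfolding C_def by blast
      qed
      then obtain X :: "nat \<Rightarrow> nat \<Rightarrow> 's" where X: "\<And>n. range (X n) \<subseteq> carrier S" "\<And>n. B n = (\<Union>k. A (X n k))"
        by metis
      define Y where "Y i = X (fst (prod_decode i)) (snd (prod_decode i))" for i
      have Y_enc: "Y (prod_encode (n, k)) = X n k" for n k by (simp add: Y_def)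
      have "(\<Union>n. B n) = (\<Union>i. A (Y i))"
      proof (intro equalityI subsetI)
        fix \<omega> assume "\<omega> \<in> (\<Union>n. B n)"
        then obtain n k where "\<omega> \<in> A (X n k)" by (auto simp: X(2))
        then show "\<omega> \<in> (\<Union>i. A (Y i))" unfolding Y_enc[symmetric] by blast
      qed (auto simp: X(2) Y_def)
      moreover have "range Y \<subseteq> carrier S" using X(1) by (auto simp: Y_def)
      ultimately show ?thesis unfolding C_def by blast
    qed
  qed blast
  obtain X :: "nat \<Rightarrow> 's" where "range X \<subseteq> carrier S" and E_eq: "E = (\<Union>n. A (X n))"
    using E[unfolded C_def] by (elim CollectE exE conjE)
  then have X: "X n \<in> carrier S" for n by blast
  have [measurable]: "E \<in> sets M" unfolding E_eq by (intro sets.countable_nat_UN image_subsetI A X)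
  define u :: "'w \<Rightarrow> ereal" where "u \<omega> = (if \<omega> \<in> E then \<infinity> else 0)" for \<omega>
  have [measurable]: "u \<in> borel_measurable M" unfolding u_def by measurable
  define T where "T = {L0_ext M \<parallel>x\<parallel> |x. x \<in> carrier S}"
  have ext: "L0_ext M \<parallel>x\<parallel> = rv_class M (\<lambda>\<omega>. ereal (nrm x \<omega>))" for x
    by (simp add: L0_ext_def nrm_def)
  have ext_meas: "(\<lambda>\<omega>. ereal (nrm x \<omega>)) \<in> borel_measurable M" if "x \<in> carrier S" for x
    using nrm_measurable[OF that] by measurable
  have "least (L0bar M) (rv_class M u) (Upper (L0bar M) T)"
  proof (rule least_UpperI)
    fix Y assume "Y \<in> T"
    then obtain x where x: "x \<in> carrier S" and Y: "Y = rv_class M (\<lambda>\<omega>. ereal (nrm x \<omega>))"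
      by (auto simp: T_def ext)
    have "A x \<in> C" unfolding C_def using x by (auto intro!: exI[of _ "\<lambda>_. x"])
    then have "AE \<omega> in M. \<omega> \<in> A x \<longrightarrow> \<omega> \<in> E" by (rule E_max)
    then have "AE \<omega> in M. rep Y \<omega> \<le> rep (rv_class M u) \<omega>"
      using rep_rv_class(2)[OF ext_meas[OF x]] rep_rv_class(2)[of u M, OF \<open>u \<in> borel_measurable M\<close>] AE_space
    proof eventually_elim
      case (elim \<omega>)
      then show ?case by (auto simp: Y u_def A_def not_less)
    qed
    then show "Y \<sqsubseteq>\<^bsub>L0bar M\<^esub> rv_class M u" by (simp add: L0bar_def rv_le_def)
  next
    fix Y assume Y: "Y \<in> Upper (L0bar M) T"
    have ub: "AE \<omega> in M. ereal (nrm x \<omega>) \<le> rep Y \<omega>" if x: "x \<in> carrier S" for x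
    proof -
      have "L0_ext M \<parallel>x\<parallel> \<in> T \<inter> carrier (L0bar M)"
        using x ext_meas[OF x] by (auto simp: T_def ext L0bar_def RV_def)
      then have "rv_le M (L0_ext M \<parallel>x\<parallel>) Y" using Y by (auto simp: Upper_def L0bar_def)
      then show ?thesis unfolding rv_le_def ext
        using rep_rv_class(2)[OF ext_meas[OF x]] by eventually_elim simp
    qed
    have "AE \<omega> in M. ereal (real k * nrm (X n) \<omega>) \<le> rep Y \<omega>" for k n
      using ub[of "rv_class M (\<lambda>_. real k) \<odot> X n"] nrm_smult[of "\<lambda>_. real k" "X n"] X
      by (auto elim!: eventually_elim2)
    then have "AE \<omega> in M. \<forall>n k. ereal (real k * nrm (X n) \<omega>) \<le> rep Y \<omega>"
      unfolding AE_all_countable by blast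
    then have "AE \<omega> in M. rep (rv_class M u) \<omega> \<le> rep Y \<omega>"
      using rep_rv_class(2)[of u M, OF \<open>u \<in> borel_measurable M\<close>]
    proof eventually_elim
      case (elim \<omega>)
      have "0 \<le> rep Y \<omega>" using elim(1)[rule_format, of 0 0] by (simp add: zero_ereal_def)
      moreover have "rep Y \<omega> = \<infinity>" if in_E: "\<omega> \<in> E"
      proof (rule ereal_top)
        fix B :: real
        obtain n where n: "0 < nrm (X n) \<omega>" using in_E by (auto simp: E_eq A_def)
        obtain k where "B < real k * nrm (X n) \<omega>" using reals_Archimedean3[OF n] by blast
        then have "ereal B \<le> ereal (real k * nrm (X n) \<omega>)" by simp
        also have "\<dots> \<le> rep Y \<omega>" using elim(1) by blast
        finally show "ereal B \<le> rep Y \<omega>" .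
      qed
      ultimately show ?case using elim(2) by (auto simp: u_def)
    qed
    then show "rv_class M u \<sqsubseteq>\<^bsub>L0bar M\<^esub> Y" by (simp add: L0bar_def rv_le_def)
  qed (use ext_meas in \<open>auto simp: T_def ext L0bar_def RV_def\<close>)
  then have "least (L0bar M) (\<Squnion>\<^bsub>L0bar M\<^esub> T) (Upper (L0bar M) T)"
    unfolding sup_def by (rule someI)
  then have "\<Squnion>\<^bsub>L0bar M\<^esub> T \<in> RV M" using least_closed by (force simp: L0bar_def)
  then have [measurable]: "rep (\<Squnion>\<^bsub>L0bar M\<^esub> T) \<in> borel_measurable M" by (rule rep_RV(1))
  show ?thesis unfolding H_of_def ev_pos_def T_def[symmetric]
    by (rule rep_ev_class(1)) measurable
qed

text \<open>Exhaustion among the events inside \<open>H(S)\<close> of rank at least two yields a largest one, which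
  satisfies the description of \<open>G(S)\<close>. It is the only such event: if \<open>G\<^sub>1\<close> and \<open>G\<^sub>2\<close> both qualify, then
  \<open>G\<^sub>2 - G\<^sub>1\<close> has rank at least two as a part of \<open>G\<^sub>2\<close>, so it is null by the maximality of \<open>G\<^sub>1\<close>.\<close>

lemma two_dimensional_on_G:
  assumes complete: "rn_complete M S" and pos: "ev_prob M (G_of M S) > 0"
  shows "two_dimensional_on (rep (G_of M S))"
proof -
  let ?H = "rep (H_of M S)"
  have Hm[measurable]: "?H \<in> sets M" by (rule H_of_measurable)
  define P where "P G \<longleftrightarrow> G \<in> Ev M \<and> ev_subset M G (H_of M S) \<and> ev_prob M G > 0 \<and> rank_ge2 M S G \<and>
    (\<forall>D\<in>Ev M. ev_subset M D (ev_Diff M (H_of M S) G) \<and> ev_prob M D > 0 \<longrightarrow> \<not> rank_ge2 M S D)" for G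
  have Diff: "ev_subset M D (ev_Diff M (H_of M S) G) \<longleftrightarrow>
      (AE \<omega> in M. \<omega> \<in> rep D \<longrightarrow> \<omega> \<in> ?H \<and> \<omega> \<notin> rep G)" if "G \<in> Ev M" for D G
  proof -
    have "AE \<omega> in M. \<omega> \<in> rep (ev_Diff M (H_of M S) G) \<longleftrightarrow> \<omega> \<in> ?H - rep G"
      unfolding ev_Diff_def using rep_Ev(1)[OF that] by (intro rep_ev_class(2)) auto
    then have "AE \<omega> in M. (\<omega> \<in> rep D \<longrightarrow> \<omega> \<in> rep (ev_Diff M (H_of M S) G)) \<longleftrightarrow>
        (\<omega> \<in> rep D \<longrightarrow> \<omega> \<in> ?H \<and> \<omega> \<notin> rep G)"
      by eventually_elim auto
    then show ?thesis unfolding ev_subset_def by (rule eventually_subst)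
  qed
  have ex_E: "\<exists>E\<in>Ev M. ev_subset M E (H_of M S) \<and> ev_prob M E > 0 \<and> rank_ge2 M S E"
  proof (rule ccontr)
    assume "\<not> ?thesis"
    then have "G_of M S = ev_class M {}" unfolding G_of_def by (rule if_not_P)
    then show False using pos rep_ev_class(2)[of "{}" M] ev_prob_pos_iff[of "G_of M S"]
      by (auto simp: ev_class_in_Ev)
  qed
  define C where "C = {F \<in> sets M. (AE \<omega> in M. \<omega> \<in> F \<longrightarrow> \<omega> \<in> ?H) \<and> two_dimensional_on F}"
  have C_I: "rep D \<in> C" if "D \<in> Ev M" "AE \<omega> in M. \<omega> \<in> rep D \<longrightarrow> \<omega> \<in> ?H" "rank_ge2 M S D" for D
    using that by (auto simp: C_def rep_Ev rank_ge2_iff)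
  obtain E0 where E0: "E0 \<in> Ev M" "ev_subset M E0 (H_of M S)" "ev_prob M E0 > 0" "rank_ge2 M S E0"
    using ex_E by blast
  obtain E where E: "E \<in> C" and E_max: "\<And>F. F \<in> C \<Longrightarrow> AE \<omega> in M. \<omega> \<in> F \<longrightarrow> \<omega> \<in> E"
  proof (rule exhaustion[of C])
    show "C \<noteq> {}" using E0 C_I[of E0] by (auto simp: ev_subset_def)
    show "(\<Union>n. A n) \<in> C" if "range A \<subseteq> C" for A :: "nat \<Rightarrow> 'w set"
    proof -
      have A: "A n \<in> sets M" "AE \<omega> in M. \<omega> \<in> A n \<longrightarrow> \<omega> \<in> ?H" "two_dimensional_on (A n)" for n
        using that by (auto simp: C_def)
      have "AE \<omega> in M. \<forall>n. \<omega> \<in> A n \<longrightarrow> \<omega> \<in> ?H" unfolding AE_all_countable using A(2) by blast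
      then have "AE \<omega> in M. \<omega> \<in> (\<Union>n. A n) \<longrightarrow> \<omega> \<in> ?H" by eventually_elim auto
      then show ?thesis using A two_dimensional_on_UN[OF complete A(1) A(3)] by (auto simp: C_def)
    qed
  qed (auto simp: C_def)
  have Em: "E \<in> sets M" using E by (simp add: C_def)
  define G where "G = ev_class M E"
  have G: "G \<in> Ev M" unfolding G_def using Em by (rule ev_class_in_Ev)
  have G_E: "AE \<omega> in M. \<omega> \<in> rep G \<longleftrightarrow> \<omega> \<in> E" unfolding G_def using Em by (rule rep_ev_class(2))
  have "P G"
    unfolding P_def
  proof (intro conjI ballI impI)
    show "ev_subset M G (H_of M S)"
    proof -
      have "AE \<omega> in M. \<omega> \<in> E \<longrightarrow> \<omega> \<in> ?H" using E by (simp add: C_def)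
      then show ?thesis using G_E unfolding ev_subset_def by eventually_elim auto
    qed
    have "AE \<omega> in M. \<omega> \<in> rep E0 \<longrightarrow> \<omega> \<in> E"
      using E0 by (intro E_max C_I) (auto simp: ev_subset_def)
    then have "AE \<omega> in M. \<omega> \<notin> rep E0" if "AE \<omega> in M. \<omega> \<notin> rep G"
      using that G_E by eventually_elim auto
    then show "ev_prob M G > 0"
      using E0(3) unfolding ev_prob_pos_iff[OF G] ev_prob_pos_iff[OF E0(1)] by blast
    have "AE \<omega> in M. \<omega> \<in> rep G \<longrightarrow> \<omega> \<in> E" using G_E by eventually_elim auto
    moreover have "two_dimensional_on E" using E by (simp add: C_def)
    ultimately show "rank_ge2 M S G" unfolding rank_ge2_iff[OF G] by (rule two_dimensional_on_mono[rotated])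
  next
    fix D assume D: "D \<in> Ev M" and *: "ev_subset M D (ev_Diff M (H_of M S) G) \<and> ev_prob M D > 0"
    then have sub: "AE \<omega> in M. \<omega> \<in> rep D \<longrightarrow> \<omega> \<in> ?H \<and> \<omega> \<notin> rep G" using Diff[OF G] by simp
    show "\<not> rank_ge2 M S D"
    proof
      assume r: "rank_ge2 M S D"
      have "AE \<omega> in M. \<omega> \<in> rep D \<longrightarrow> \<omega> \<in> ?H" using sub by eventually_elim auto
      then have "AE \<omega> in M. \<omega> \<in> rep D \<longrightarrow> \<omega> \<in> E" by (intro E_max C_I D r)
      then have "AE \<omega> in M. \<omega> \<notin> rep D" using sub G_E by eventually_elim auto
      then show False using * ev_prob_pos_iff[OF D] by simp
    qed
  qed (rule G)
  moreover have "G1 = G2" if P: "P G1" "P G2" for G1 G2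
  proof -
    have half: "AE \<omega> in M. \<omega> \<in> rep G2 \<longrightarrow> \<omega> \<in> rep G1" if P: "P G1" "P G2" for G1 G2
    proof -
      have Ev: "G1 \<in> Ev M" "G2 \<in> Ev M" using P by (auto simp: P_def)
      note [measurable] = rep_Ev(1)[OF Ev(1)] rep_Ev(1)[OF Ev(2)]
      define D where "D = ev_class M (rep G2 - rep G1)"
      have D: "D \<in> Ev M" unfolding D_def by (intro ev_class_in_Ev) auto
      have D_eq: "AE \<omega> in M. \<omega> \<in> rep D \<longleftrightarrow> \<omega> \<in> rep G2 - rep G1"
        unfolding D_def by (intro rep_ev_class(2)) auto
      have "two_dimensional_on (rep G2)" using P Ev rank_ge2_iff by (auto simp: P_def)
      moreover have "AE \<omega> in M. \<omega> \<in> rep D \<longrightarrow> \<omega> \<in> rep G2" using D_eq by eventually_elim auto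
      ultimately have "rank_ge2 M S D" unfolding rank_ge2_iff[OF D] by (rule two_dimensional_on_mono)
      moreover have "AE \<omega> in M. \<omega> \<in> rep G2 \<longrightarrow> \<omega> \<in> ?H" using P by (auto simp: P_def ev_subset_def)
      then have "AE \<omega> in M. \<omega> \<in> rep D \<longrightarrow> \<omega> \<in> ?H \<and> \<omega> \<notin> rep G1" using D_eq by eventually_elim auto
      ultimately have "\<not> ev_prob M D > 0" using P(1) D Diff[OF Ev(1)] by (auto simp: P_def)
      then have "AE \<omega> in M. \<omega> \<notin> rep D" using ev_prob_pos_iff[OF D] by simp
      then show ?thesis using D_eq by eventually_elim auto
    qed
    have "AE \<omega> in M. \<omega> \<in> rep G1 \<longleftrightarrow> \<omega> \<in> rep G2"
      using half[OF P] half[OF P(2,1)] by eventually_elim auto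
    then have "ev_class M (rep G1) = ev_class M (rep G2)" by (rule ev_class_cong)
    then show ?thesis using P rep_Ev(2) by (metis P_def)
  qed
  ultimately have "P (THE G. P G)" by (intro theI[of P]) auto
  also have "(THE G. P G) = G_of M S" unfolding G_of_def P_def by (simp only: if_P[OF ex_E])
  finally have "G_of M S \<in> Ev M" "rank_ge2 M S (G_of M S)" by (auto simp: P_def)
  then show ?thesis using rank_ge2_iff by blast
qed

section \<open>Pairs on the sphere at prescribed distance\<close>

text \<open>The path runs from \<open>x = u / \<parallel>u\<parallel>\<close> through \<open>v / \<parallel>v\<parallel>\<close> to \<open>-x\<close>. By independence it misses the origin,
  since its two coordinates never vanish together, and it ends at the distance \<open>2 \<ge> \<epsilon>\<close> from \<open>x\<close>.\<close>

lemma unit_pair_at_distance: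
  assumes uv: "u \<in> carrier S" "v \<in> carrier S" and ind: "independent_on D u v"
    and \<epsilon>[measurable]: "\<epsilon> \<in> borel_measurable M"
    and \<epsilon>_range: "AE \<omega> in M. \<omega> \<in> D \<longrightarrow> 0 \<le> \<epsilon> \<omega> \<and> \<epsilon> \<omega> \<le> 2"
  obtains x y where "x \<in> carrier S" "y \<in> carrier S"
    "AE \<omega> in M. \<omega> \<in> D \<longrightarrow> nrm x \<omega> = 1 \<and> nrm y \<omega> = 1 \<and> nrm (x \<ominus> y) \<omega> = \<epsilon> \<omega>"
proof -
  note [measurable] = nrm_measurable[OF uv(1)] nrm_measurable[OF uv(2)]
  have indep: "AE \<omega> in M. \<omega> \<in> D \<longrightarrow> nrm (comb f u g v) \<omega> = 0 \<longrightarrow> f \<omega> = 0 \<and> g \<omega> = 0"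
    if "f \<in> borel_measurable M" "g \<in> borel_measurable M" for f g
  proof -
    have "AE \<omega> in M. \<omega> \<in> D \<and> nrm (comb f u g v) \<omega> = 0 \<longrightarrow> f \<omega> = 0 \<and> g \<omega> = 0"
      using ind that unfolding independent_on_def by blast
    then show ?thesis by eventually_elim auto
  qed
  have u_pos: "AE \<omega> in M. \<omega> \<in> D \<longrightarrow> 0 < nrm u \<omega>"
    using indep[of "\<lambda>_. 1" "\<lambda>_. 0", OF borel_measurable_const borel_measurable_const] nrm_nonneg[OF uv(1)] by eventually_elim (auto simp: comb_basis uv)
  have v_pos: "AE \<omega> in M. \<omega> \<in> D \<longrightarrow> 0 < nrm v \<omega>"
    using indep[of "\<lambda>_. 0" "\<lambda>_. 1", OF borel_measurable_const borel_measurable_const] nrm_nonneg[OF uv(2)] by eventually_elim (auto simp: comb_basis uv)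
  define a where "a \<omega> = 1 / nrm u \<omega>" for \<omega>
  define b where "b \<omega> = 1 / nrm v \<omega>" for \<omega>
  have [measurable]: "a \<in> borel_measurable M" "b \<in> borel_measurable M"
    unfolding a_def b_def by measurable
  define x where "x = comb a u (\<lambda>_. 0) v"
  define w where "w = comb (\<lambda>_. 0) u b v"
  have x: "x \<in> carrier S" and w: "w \<in> carrier S" unfolding x_def w_def using uv by auto
  have x_unit: "AE \<omega> in M. \<omega> \<in> D \<longrightarrow> nrm x \<omega> = 1"
  proof -
    have "AE \<omega> in M. nrm x \<omega> = \<bar>a \<omega>\<bar> * nrm u \<omega>"
      using nrm_comb_scale[of a "\<lambda>_. 1" "\<lambda>_. 0" u v] uv by (simp add: x_def comb_basis)
    then show ?thesis using u_pos by eventually_elim (auto simp: a_def)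
  qed
  have w_unit: "AE \<omega> in M. \<omega> \<in> D \<longrightarrow> nrm w \<omega> = 1"
  proof -
    have "AE \<omega> in M. nrm w \<omega> = \<bar>b \<omega>\<bar> * nrm v \<omega>"
      using nrm_comb_scale[of b "\<lambda>_. 0" "\<lambda>_. 1" u v] uv by (simp add: w_def comb_basis)
    then show ?thesis using v_pos by eventually_elim (auto simp: b_def)
  qed
  have unit: "AE \<omega> in M. \<omega> \<in> D \<longrightarrow> nrm x \<omega> = 1 \<and> nrm w \<omega> = 1"
    using x_unit w_unit by eventually_elim auto
  have bent_path_pos: "AE \<omega> in M. \<omega> \<in> D \<longrightarrow> 0 < nrm (bent_path x w f) \<omega>"
    if [measurable]: "f \<in> borel_measurable M" and f: "\<And>\<omega>. 0 \<le> f \<omega>" "\<And>\<omega>. f \<omega> \<le> 2" for f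
  proof -
    have eq: "bent_path x w f = comb (\<lambda>\<omega>. (1 - f \<omega>) * a \<omega>) u (\<lambda>\<omega>. (1 - \<bar>1 - f \<omega>\<bar>) * b \<omega>) v"
      unfolding bent_path_def x_def w_def using uv by (simp add: comb_comb)
    have "AE \<omega> in M. \<omega> \<in> D \<longrightarrow> nrm (bent_path x w f) \<omega> = 0 \<longrightarrow>
        (1 - f \<omega>) * a \<omega> = 0 \<and> (1 - \<bar>1 - f \<omega>\<bar>) * b \<omega> = 0"
      unfolding eq by (intro indep) auto
    moreover have "AE \<omega> in M. 0 \<le> nrm (bent_path x w f) \<omega>" using x w by (intro nrm_nonneg) auto
    ultimately show ?thesis using u_pos v_pos
    proof eventually_elim
      case (elim \<omega>)
      show ?case
      proof (rule impI, rule ccontr)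
        assume D: "\<omega> \<in> D" and "\<not> 0 < nrm (bent_path x w f) \<omega>"
        then have "(1 - f \<omega>) * a \<omega> = 0 \<and> (1 - \<bar>1 - f \<omega>\<bar>) * b \<omega> = 0" using elim by auto
        moreover have "a \<omega> \<noteq> 0" "b \<omega> \<noteq> 0" using elim D by (auto simp: a_def b_def)
        ultimately show False by auto
      qed
    qed
  qed
  have bent_path2: "bent_path x w (\<lambda>_. 2) = comb (\<lambda>_. -1) x (\<lambda>_. 0) w" by (simp add: bent_path_def)
  have diff2: "x \<ominus> bent_path x w (\<lambda>_. 2) = comb (\<lambda>_. 2) x (\<lambda>_. 0) w"
    using comb_comb[of "\<lambda>_. 1" "\<lambda>_. -1" "\<lambda>_. 1" "\<lambda>_. 0" "\<lambda>_. -1" "\<lambda>_. 0" x w] x w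
    by (simp add: bent_path2 comb_basis)
  have far: "AE \<omega> in M. \<omega> \<in> D \<longrightarrow> nrm (bent_path x w (\<lambda>_. 2)) \<omega> = 1 \<and> \<epsilon> \<omega> \<le> nrm (x \<ominus> bent_path x w (\<lambda>_. 2)) \<omega>"
  proof -
    have "AE \<omega> in M. nrm (bent_path x w (\<lambda>_. 2)) \<omega> = nrm x \<omega>"
      "AE \<omega> in M. nrm (x \<ominus> bent_path x w (\<lambda>_. 2)) \<omega> = 2 * nrm x \<omega>"
      unfolding diff2 unfolding bent_path2
      using nrm_comb_scale[of "\<lambda>_. -1" "\<lambda>_. 1" "\<lambda>_. 0" x w] nrm_comb_scale[of "\<lambda>_. 2" "\<lambda>_. 1" "\<lambda>_. 0" x w] x w
      by (simp_all add: comb_basis)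
    then show ?thesis using x_unit \<epsilon>_range by eventually_elim auto
  qed
  obtain t y where t: "t \<in> borel_measurable M" and y_eq: "y = rv_class M (\<lambda>\<omega>. 1 / nrm (bent_path x w t) \<omega>) \<odot> bent_path x w t"
    and y: "AE \<omega> in M. \<omega> \<in> D \<longrightarrow> nrm y \<omega> = 1 \<and> nrm (x \<ominus> y) \<omega> = \<epsilon> \<omega>"
    by (rule bent_path_hits_sphere[OF x w unit \<epsilon> \<epsilon>_range _ bent_path_pos far]) auto
  have [measurable]: "nrm (bent_path x w t) \<in> borel_measurable M" using t x w by auto
  have "y \<in> carrier S" unfolding y_eq using t x w by auto
  moreover have "AE \<omega> in M. \<omega> \<in> D \<longrightarrow> nrm x \<omega> = 1 \<and> nrm y \<omega> = 1 \<and> nrm (x \<ominus> y) \<omega> = \<epsilon> \<omega>"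
    using y x_unit by eventually_elim auto
  ultimately show thesis using that x by blast
qed

lemma ball_pair_dominated_by_sphere_pair:
  assumes D[measurable]: "D \<in> sets M" and two_dim: "two_dimensional_on D"
    and \<epsilon>[measurable]: "\<epsilon> \<in> borel_measurable M"
    and \<epsilon>_range: "AE \<omega> in M. \<omega> \<in> D \<longrightarrow> 0 < \<epsilon> \<omega> \<and> \<epsilon> \<omega> \<le> 2"
    and xy: "x \<in> carrier S" "y \<in> carrier S"
    and ball: "AE \<omega> in M. \<omega> \<in> D \<longrightarrow> nrm x \<omega> \<le> 1 \<and> nrm y \<omega> \<le> 1"
    and far: "AE \<omega> in M. \<omega> \<in> D \<longrightarrow> \<epsilon> \<omega> \<le> nrm (x \<ominus> y) \<omega>"
  obtains X Y where "X \<in> carrier S" "Y \<in> carrier S"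
    "AE \<omega> in M. \<omega> \<in> D \<longrightarrow> nrm X \<omega> = 1 \<and> nrm Y \<omega> = 1 \<and> nrm (X \<ominus> Y) \<omega> = \<epsilon> \<omega> \<and>
      nrm (x \<oplus> y) \<omega> \<le> nrm (X \<oplus> Y) \<omega>"
proof -
  have [measurable]: "nrm (x \<oplus> y) \<in> borel_measurable M" using xy by auto
  \<comment> \<open>On \<open>E\<close> the given pair is deformed; on the rest of \<open>D\<close> any unit pair at distance \<open>\<epsilon>\<close>
    has a sum of norm at least \<open>2 - \<epsilon>\<close>, which is enough.\<close>
  define E where "E = {\<omega> \<in> D. 2 - \<epsilon> \<omega> < nrm (x \<oplus> y) \<omega>}"
  have E[measurable]: "E \<in> sets M" unfolding E_def by measurable
  have ED: "E \<subseteq> D" by (auto simp: E_def)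
  have "AE \<omega> in M. \<omega> \<in> E \<longrightarrow> nrm x \<omega> \<le> 1 \<and> nrm y \<omega> \<le> 1"
    using ball by eventually_elim (use ED in auto)
  moreover have "AE \<omega> in M. \<omega> \<in> E \<longrightarrow> nrm (x \<oplus> y) \<omega> + nrm (x \<ominus> y) \<omega> > 2"
    using far by eventually_elim (auto simp: E_def)
  ultimately obtain y1 where y1: "y1 \<in> carrier S" and y1_props: "AE \<omega> in M. \<omega> \<in> E \<longrightarrow> nrm y1 \<omega> = 1 \<and>
      nrm (x \<oplus> y) \<omega> \<le> nrm (x \<oplus> y1) \<omega> \<and> nrm (x \<ominus> y) \<omega> \<le> nrm (x \<ominus> y1) \<omega>"
    using push_to_sphere[OF xy] by blast
  have "AE \<omega> in M. \<omega> \<in> E \<longrightarrow> nrm y1 \<omega> \<le> 1 \<and> nrm x \<omega> \<le> 1"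
    using ball y1_props by eventually_elim (use ED in auto)
  moreover have "AE \<omega> in M. \<omega> \<in> E \<longrightarrow> nrm (y1 \<oplus> x) \<omega> + nrm (y1 \<ominus> x) \<omega> > 2"
    using far y1_props nrm_minus_commute[OF xy(1) y1]
    by eventually_elim (auto simp: E_def M.a_comm[OF y1 xy(1)])
  ultimately obtain x1 where x1: "x1 \<in> carrier S" and x1_props: "AE \<omega> in M. \<omega> \<in> E \<longrightarrow> nrm x1 \<omega> = 1 \<and>
      nrm (y1 \<oplus> x) \<omega> \<le> nrm (y1 \<oplus> x1) \<omega> \<and> nrm (y1 \<ominus> x) \<omega> \<le> nrm (y1 \<ominus> x1) \<omega>"
    using push_to_sphere[OF y1 xy(1)] by blast
  have pushed: "AE \<omega> in M. \<omega> \<in> E \<longrightarrow> nrm x1 \<omega> = 1 \<and> nrm y1 \<omega> = 1 \<and> \<epsilon> \<omega> \<le> nrm (x1 \<ominus> y1) \<omega> \<and>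
      nrm (x \<oplus> y) \<omega> \<le> nrm (x1 \<oplus> y1) \<omega> \<and> 0 < nrm (x1 \<oplus> y1) \<omega> \<and> 0 < \<epsilon> \<omega> \<and> \<epsilon> \<omega> \<le> 2"
    using y1_props x1_props far \<epsilon>_range nrm_minus_commute[OF xy(1) y1] nrm_minus_commute[OF x1 y1]
  proof eventually_elim
    case (elim \<omega>)
    show ?case
    proof
      assume \<omega>: "\<omega> \<in> E"
      then have "\<omega> \<in> D" "2 - \<epsilon> \<omega> < nrm (x \<oplus> y) \<omega>" by (auto simp: E_def)
      then show "nrm x1 \<omega> = 1 \<and> nrm y1 \<omega> = 1 \<and> \<epsilon> \<omega> \<le> nrm (x1 \<ominus> y1) \<omega> \<and>
          nrm (x \<oplus> y) \<omega> \<le> nrm (x1 \<oplus> y1) \<omega> \<and> 0 < nrm (x1 \<oplus> y1) \<omega> \<and> 0 < \<epsilon> \<omega> \<and> \<epsilon> \<omega> \<le> 2"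
        using elim \<omega> by (auto simp: M.a_comm[OF y1 xy(1)] M.a_comm[OF y1 x1])
    qed
  qed
  have "AE \<omega> in M. \<omega> \<in> E \<longrightarrow> nrm x1 \<omega> = 1 \<and> nrm y1 \<omega> = 1" using pushed by eventually_elim auto
  moreover have "AE \<omega> in M. \<omega> \<in> E \<longrightarrow> 0 < \<epsilon> \<omega> \<and> \<epsilon> \<omega> \<le> 2" using pushed by eventually_elim auto
  moreover have "AE \<omega> in M. \<omega> \<in> E \<longrightarrow> \<epsilon> \<omega> \<le> nrm (x1 \<ominus> y1) \<omega>" using pushed by eventually_elim auto
  moreover have "AE \<omega> in M. \<omega> \<in> E \<longrightarrow> 0 < nrm (x1 \<oplus> y1) \<omega>" using pushed by eventually_elim auto
  ultimately obtain y2 where y2: "y2 \<in> carrier S" and y2_props: "AE \<omega> in M. \<omega> \<in> E \<longrightarrow> nrm y2 \<omega> = 1 \<and>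
      nrm (x1 \<ominus> y2) \<omega> = \<epsilon> \<omega> \<and> nrm (x1 \<oplus> y1) \<omega> \<le> nrm (x1 \<oplus> y2) \<omega>"
    using slide_along_arc[OF x1 y1 _ \<epsilon>] by blast
  obtain u v where uv: "u \<in> carrier S" "v \<in> carrier S" "independent_on D u v"
    using two_dim by (auto simp: two_dimensional_on_def)
  have "AE \<omega> in M. \<omega> \<in> D \<longrightarrow> 0 \<le> \<epsilon> \<omega> \<and> \<epsilon> \<omega> \<le> 2" using \<epsilon>_range by eventually_elim auto
  then obtain x0 y0 where x0: "x0 \<in> carrier S" and y0: "y0 \<in> carrier S"
    and base: "AE \<omega> in M. \<omega> \<in> D \<longrightarrow> nrm x0 \<omega> = 1 \<and> nrm y0 \<omega> = 1 \<and> nrm (x0 \<ominus> y0) \<omega> = \<epsilon> \<omega>"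
    using unit_pair_at_distance[OF uv \<epsilon>] by blast
  have base_sum: "AE \<omega> in M. \<bar>2\<bar> * nrm (comb (\<lambda>_. 1) x0 (\<lambda>_. 0) y0) \<omega> \<le>
      \<bar>1\<bar> * nrm (comb (\<lambda>_. 1) x0 (\<lambda>_. 1) y0) \<omega> + \<bar>1\<bar> * nrm (comb (\<lambda>_. 1) x0 (\<lambda>_. -1) y0) \<omega>"
    using x0 y0 by (intro nrm_comb_le) auto
  let ?X = "patch E x1 x0" and ?Y = "patch E y2 y0"
  have minus: "?X \<ominus> ?Y = patch E (x1 \<ominus> y2) (x0 \<ominus> y0)" and plus: "?X \<oplus> ?Y = patch E (x1 \<oplus> y2) (x0 \<oplus> y0)"
    using x0 y0 x1 y2 E by (simp_all add: patch_minus patch_plus)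
  have "AE \<omega> in M. nrm ?X \<omega> = (if \<omega> \<in> E then nrm x1 \<omega> else nrm x0 \<omega>)"
    "AE \<omega> in M. nrm ?Y \<omega> = (if \<omega> \<in> E then nrm y2 \<omega> else nrm y0 \<omega>)"
    "AE \<omega> in M. nrm (?X \<ominus> ?Y) \<omega> = (if \<omega> \<in> E then nrm (x1 \<ominus> y2) \<omega> else nrm (x0 \<ominus> y0) \<omega>)"
    "AE \<omega> in M. nrm (?X \<oplus> ?Y) \<omega> = (if \<omega> \<in> E then nrm (x1 \<oplus> y2) \<omega> else nrm (x0 \<oplus> y0) \<omega>)"
    unfolding minus plus by (rule nrm_patch; use x0 y0 x1 y2 E in simp)+
  then have "AE \<omega> in M. \<omega> \<in> D \<longrightarrow> nrm ?X \<omega> = 1 \<and> nrm ?Y \<omega> = 1 \<and> nrm (?X \<ominus> ?Y) \<omega> = \<epsilon> \<omega> \<and>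
      nrm (x \<oplus> y) \<omega> \<le> nrm (?X \<oplus> ?Y) \<omega>"
    using pushed y2_props base base_sum
  proof eventually_elim
    case (elim \<omega>)
    note e = elim[unfolded comb_basis[OF x0 y0]]
    show ?case
    proof (cases "\<omega> \<in> E")
      case True
      then show ?thesis using e by auto
    next
      case False
      then have "nrm (x \<oplus> y) \<omega> \<le> 2 - \<epsilon> \<omega>" if "\<omega> \<in> D" using that by (simp add: E_def)
      then show ?thesis using e False by auto
    qed
  qed
  then show thesis using that[of ?X ?Y] x0 y0 x1 y2 E by blast
qed

section \<open>The moduli of convexity\<close>

lemma convexity_gap_eq:
  assumes D: "D \<in> Ev M" and xy: "x \<in> carrier S" "y \<in> carrier S"
  shows "convexity_gap M S D x y =
    rv_class M (\<lambda>\<omega>. ereal (indicator (rep D) \<omega> * (1 - nrm (x \<oplus> y) \<omega> / 2)))"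
proof -
  note [measurable] = rep_Ev(1)[OF D]
  have [measurable]: "nrm (x \<oplus> y) \<in> borel_measurable M" using xy by auto
  have minus: "rv_class M f \<ominus>\<^bsub>L0 M\<^esub> rv_class M g = rv_class M (\<lambda>\<omega>. f \<omega> - g \<omega>)"
    if [measurable]: "f \<in> borel_measurable M" "g \<in> borel_measurable M" for f g :: "'w \<Rightarrow> real"
  proof -
    have "rv_class M (\<lambda>\<omega>. - g \<omega>) \<oplus>\<^bsub>L0 M\<^esub> rv_class M g = \<zero>\<^bsub>L0 M\<^esub>"
      by (simp add: rv_class_add) (simp add: L0_def)
    then have "\<ominus>\<^bsub>L0 M\<^esub> rv_class M g = rv_class M (\<lambda>\<omega>. - g \<omega>)"
      by (intro R.minus_equality) auto
    then show ?thesis by (simp add: R.minus_eq rv_class_add)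
  qed
  let ?g = "\<lambda>\<omega>. nrm (rv_class M (\<lambda>_. 1 / 2) \<odot> (x \<oplus> y)) \<omega>"
  have g[measurable]: "?g \<in> borel_measurable M" using xy by auto
  have ind: "L0_ind M D = rv_class M (indicator (rep D))" by (simp add: L0_ind_def)
  have eq: "L0_ind M D \<ominus>\<^bsub>L0 M\<^esub> (L0_ind M D \<otimes>\<^bsub>L0 M\<^esub> \<parallel>rv_class M (\<lambda>_. 1 / 2) \<odot> (x \<oplus> y)\<parallel>) =
      rv_class M (\<lambda>\<omega>. indicator (rep D) \<omega> - indicator (rep D) \<omega> * ?g \<omega>)"
    using xy by (simp add: ind rnorm_eq_class rv_class_mult minus)
  have "AE \<omega> in M. ?g \<omega> = \<bar>1 / 2\<bar> * nrm (x \<oplus> y) \<omega>" using xy by (intro nrm_smult) auto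
  then have "AE \<omega> in M. rep (rv_class M (\<lambda>\<omega>. indicator (rep D) \<omega> - indicator (rep D) \<omega> * ?g \<omega>)) \<omega> =
      indicator (rep D) \<omega> * (1 - nrm (x \<oplus> y) \<omega> / 2)"
    using rep_rv_class(2)[of "\<lambda>\<omega>. indicator (rep D) \<omega> - indicator (rep D) \<omega> * ?g \<omega>" M, simplified]
    by (eventually_elim, simp) (simp add: algebra_simps)
  then have "AE \<omega> in M. ereal (rep (rv_class M (\<lambda>\<omega>. indicator (rep D) \<omega> - indicator (rep D) \<omega> * ?g \<omega>)) \<omega>) =
      ereal (indicator (rep D) \<omega> * (1 - nrm (x \<oplus> y) \<omega> / 2))"
    by eventually_elim simp
  then show ?thesis unfolding convexity_gap_def eq L0_ext_def by (rule rv_class_cong)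
qed

lemma rep_A_of:
  assumes x: "x \<in> carrier S"
  shows "rep (A_of M S x) \<in> sets M" "AE \<omega> in M. \<omega> \<in> rep (A_of M S x) \<longleftrightarrow> 0 < nrm x \<omega>"
proof -
  note [measurable] = nrm_measurable[OF x]
  have meas: "{\<omega> \<in> space M. 0 < nrm x \<omega>} \<in> sets M" by measurable
  have eq: "A_of M S x = ev_class M {\<omega> \<in> space M. 0 < nrm x \<omega>}"
    by (simp add: A_of_def ev_pos_def nrm_def)
  show "rep (A_of M S x) \<in> sets M" unfolding eq by (rule rep_ev_class(1)[OF meas])
  show "AE \<omega> in M. \<omega> \<in> rep (A_of M S x) \<longleftrightarrow> 0 < nrm x \<omega>"
    unfolding eq using rep_ev_class(2)[OF meas] AE_space by eventually_elim auto
qed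

lemma rep_B_of:
  assumes xy: "x \<in> carrier S" "y \<in> carrier S"
  shows "AE \<omega> in M. \<omega> \<in> rep (B_of M S x y) \<longleftrightarrow> 0 < nrm x \<omega> \<and> 0 < nrm y \<omega> \<and> 0 < nrm (x \<ominus> y) \<omega>"
proof -
  have d: "x \<ominus> y \<in> carrier S" using xy by auto
  note [measurable] = rep_A_of(1)[OF xy(1)] rep_A_of(1)[OF xy(2)] rep_A_of(1)[OF d]
  let ?I = "ev_Int M (A_of M S x) (A_of M S y)"
  have [measurable]: "rep ?I \<in> sets M"
    and I: "AE \<omega> in M. \<omega> \<in> rep ?I \<longleftrightarrow> \<omega> \<in> rep (A_of M S x) \<inter> rep (A_of M S y)"
    unfolding ev_Int_def by (intro rep_ev_class; measurable)+
  have "AE \<omega> in M. \<omega> \<in> rep (B_of M S x y) \<longleftrightarrow> \<omega> \<in> rep ?I \<inter> rep (A_of M S (x \<ominus> y))"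
    unfolding B_of_def ev_Int_def[of M ?I] by (intro rep_ev_class(2)) measurable
  then show ?thesis using I rep_A_of(2)[OF xy(1)] rep_A_of(2)[OF xy(2)] rep_A_of(2)[OF d]
    by eventually_elim auto
qed

lemma U1_iff: "x \<in> U1 M S \<longleftrightarrow> x \<in> carrier S \<and> (AE \<omega> in M. nrm x \<omega> \<le> 1)"
  by (auto simp: U1_def L0_def rnorm_eq_class rv_le_class_iff)

lemma S1_subset_U1: "S1 M S \<subseteq> U1 M S"
proof
  fix x assume "x \<in> S1 M S"
  then obtain A where x: "x \<in> carrier S" and A: "A \<in> Ev M" "\<parallel>x\<parallel> = L0_ind M A" by (auto simp: S1_def)
  note [measurable] = rep_Ev(1)[OF A(1)]
  have "AE \<omega> in M. rep (rv_class M (indicator (rep A) :: 'w \<Rightarrow> real)) \<omega> = indicator (rep A) \<omega>"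
    by (intro rep_rv_class(2)) auto
  then have "AE \<omega> in M. nrm x \<omega> \<le> 1"
    unfolding nrm_def A(2) L0_ind_def by eventually_elim (auto simp: indicator_def)
  then show "x \<in> U1 M S" using x by (simp add: U1_iff)
qed

lemma modulus_constraints:
  assumes D: "D \<in> Ev M" and \<epsilon>: "\<epsilon> \<in> RV M" and xy: "x \<in> carrier S" "y \<in> carrier S"
  shows "rv_le M (\<epsilon> \<otimes>\<^bsub>L0 M\<^esub> L0_ind M D) (L0_ind M D \<otimes>\<^bsub>L0 M\<^esub> \<parallel>x \<ominus> y\<parallel>) \<longleftrightarrow>
      (AE \<omega> in M. \<omega> \<in> rep D \<longrightarrow> rep \<epsilon> \<omega> \<le> nrm (x \<ominus> y) \<omega>)" (is ?le)
    and "(AE \<omega> in M. \<omega> \<in> rep D \<longrightarrow> nrm (x \<ominus> y) \<omega> = rep \<epsilon> \<omega>) \<Longrightarrow>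
      L0_ind M D \<otimes>\<^bsub>L0 M\<^esub> \<parallel>x \<ominus> y\<parallel> = \<epsilon> \<otimes>\<^bsub>L0 M\<^esub> L0_ind M D" (is "?A \<Longrightarrow> ?eq")
proof -
  note [measurable] = rep_Ev(1)[OF D] rep_RV(1)[OF \<epsilon>]
  have d[measurable]: "nrm (x \<ominus> y) \<in> borel_measurable M" using xy by auto
  have l: "\<epsilon> \<otimes>\<^bsub>L0 M\<^esub> L0_ind M D = rv_class M (\<lambda>\<omega>. rep \<epsilon> \<omega> * indicator (rep D) \<omega>)"
    using rv_class_mult[of "rep \<epsilon>" M "indicator (rep D)"] by (simp add: rep_RV(2)[OF \<epsilon>] L0_ind_def)
  have r: "L0_ind M D \<otimes>\<^bsub>L0 M\<^esub> \<parallel>x \<ominus> y\<parallel> = rv_class M (\<lambda>\<omega>. indicator (rep D) \<omega> * nrm (x \<ominus> y) \<omega>)"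
    using xy by (simp add: L0_ind_def rnorm_eq_class rv_class_mult)
  show ?le unfolding l r by (subst rv_le_class_iff) (auto simp: indicator_def)
  assume ?A
  then have "AE \<omega> in M. indicator (rep D) \<omega> * nrm (x \<ominus> y) \<omega> = rep \<epsilon> \<omega> * indicator (rep D) \<omega>"
    by eventually_elim (simp add: indicator_def)
  then show ?eq unfolding l r by (rule rv_class_cong)
qed

end

theorem theorem1p2:
  fixes M :: "'w measure"
    and S :: "(('w \<Rightarrow> real) set, 's, 'm) rn_module_scheme"
    and D :: "'w set set"
    and \<epsilon> :: "('w \<Rightarrow> real) set"
  assumes "random_normed_module M S"
    and "rn_complete M S"
    and "ev_prob M (G_of M S) > 0"
    and "D \<in> Ev M"
    and "ev_subset M D (G_of M S)"
    and "ev_prob M D > 0"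
    and "\<epsilon> \<in> L0_pos M"
    and "AE \<omega> in M. \<omega> \<in> rep D \<longrightarrow> 0 < rep \<epsilon> \<omega> \<and> rep \<epsilon> \<omega> \<le> 2"
  shows "delta M S D \<epsilon> = delta1 M S D \<epsilon> \<and> delta1 M S D \<epsilon> = delta2 M S D \<epsilon>"
proof -
  interpret random_normed_module M S by fact
  note D = assms(4)
  have Dm[measurable]: "rep D \<in> sets M" using rep_Ev(1)[OF D] .
  have \<epsilon>: "\<epsilon> \<in> RV M" using assms(7) by (simp add: L0_pos_def L0_def)
  note \<epsilon>_range = assms(8)
  have two_dim: "two_dimensional_on (rep D)"
    using two_dimensional_on_G[OF assms(2,3)] assms(5) unfolding ev_subset_def by (rule two_dimensional_on_mono)
  let ?far = "\<lambda>x y. rv_le M (\<epsilon> \<otimes>\<^bsub>L0 M\<^esub> L0_ind M D) (L0_ind M D \<otimes>\<^bsub>L0 M\<^esub> \<parallel>x \<ominus>\<^bsub>S\<^esub> y\<parallel>\<^bsub>S\<^esub>)"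
  let ?at = "\<lambda>x y. L0_ind M D \<otimes>\<^bsub>L0 M\<^esub> \<parallel>x \<ominus>\<^bsub>S\<^esub> y\<parallel>\<^bsub>S\<^esub> = \<epsilon> \<otimes>\<^bsub>L0 M\<^esub> L0_ind M D"
  let ?B = "\<lambda>x y. ev_subset M D (B_of M S x y)"
  define T where "T = {convexity_gap M S D x y |x y. x \<in> S1 M S \<and> y \<in> S1 M S \<and> ?B x y \<and> ?far x y}"
  define T1 where "T1 = {convexity_gap M S D x y |x y. x \<in> S1 M S \<and> y \<in> S1 M S \<and> ?B x y \<and> ?at x y}"
  define T2 where "T2 = {convexity_gap M S D x y |x y. x \<in> U1 M S \<and> y \<in> U1 M S \<and> ?B x y \<and> ?far x y}"
  have "?far x y" if "?at x y" for x y unfolding that by (simp add: rv_le_def)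
  then have "T1 \<subseteq> T" unfolding T_def T1_def by blast
  have "T \<subseteq> T2" unfolding T_def T2_def using S1_subset_U1 by blast
  have dominated: "\<exists>h\<in>T1 \<inter> RV M. rv_le M h g" if g: "g \<in> T2" for g
  proof -
    obtain x y where g_eq: "g = convexity_gap M S D x y" and U: "x \<in> U1 M S" "y \<in> U1 M S" and "?far x y"
      using g by (auto simp: T2_def)
    have xy: "x \<in> carrier S" "y \<in> carrier S" using U by (auto simp: U1_iff)
    have "AE \<omega> in M. \<omega> \<in> rep D \<longrightarrow> rep \<epsilon> \<omega> \<le> nrm (x \<ominus>\<^bsub>S\<^esub> y) \<omega>"
      using \<open>?far x y\<close> modulus_constraints(1)[OF D \<epsilon> xy] by simp
    moreover have "AE \<omega> in M. \<omega> \<in> rep D \<longrightarrow> nrm x \<omega> \<le> 1 \<and> nrm y \<omega> \<le> 1"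
      using U by (auto simp: U1_iff)
    ultimately obtain X Y where XY: "X \<in> carrier S" "Y \<in> carrier S"
      and props: "AE \<omega> in M. \<omega> \<in> rep D \<longrightarrow> nrm X \<omega> = 1 \<and> nrm Y \<omega> = 1 \<and> nrm (X \<ominus>\<^bsub>S\<^esub> Y) \<omega> = rep \<epsilon> \<omega> \<and>
        nrm (x \<oplus>\<^bsub>S\<^esub> y) \<omega> \<le> nrm (X \<oplus>\<^bsub>S\<^esub> Y) \<omega>"
      using ball_pair_dominated_by_sphere_pair[OF Dm two_dim rep_RV(1)[OF \<epsilon>] \<epsilon>_range xy] by blast
    \<comment> \<open>Membership in \<open>S(1)\<close> asks for an indicator as norm on all of \<open>\<Omega>\<close>, so the vectors are
      cut off outside \<open>D\<close>.\<close>
    define X' where "X' = patch (rep D) X \<zero>\<^bsub>S\<^esub>"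
    define Y' where "Y' = patch (rep D) Y \<zero>\<^bsub>S\<^esub>"
    have XY': "X' \<in> carrier S" "Y' \<in> carrier S" using XY by (auto simp: X'_def Y'_def)
    have zero: "AE \<omega> in M. nrm \<zero>\<^bsub>S\<^esub> \<omega> = 0"
      using nrm_minus_self[of "\<zero>\<^bsub>S\<^esub>"] by (simp add: M.minus_eq M.r_neg)
    have in_S1: "patch (rep D) Z \<zero>\<^bsub>S\<^esub> \<in> S1 M S"
      if Z: "Z \<in> carrier S" and Z1: "AE \<omega> in M. \<omega> \<in> rep D \<longrightarrow> nrm Z \<omega> = 1" for Z
    proof -
      have Z': "patch (rep D) Z \<zero>\<^bsub>S\<^esub> \<in> carrier S" using Z by auto
      have "AE \<omega> in M. nrm (patch (rep D) Z \<zero>\<^bsub>S\<^esub>) \<omega> = indicator (rep D) \<omega>"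
        using nrm_patch[OF Dm Z M.zero_closed] zero Z1 by eventually_elim (auto simp: indicator_def)
      then have "\<parallel>patch (rep D) Z \<zero>\<^bsub>S\<^esub>\<parallel>\<^bsub>S\<^esub> = L0_ind M D"
        unfolding rnorm_eq_class[OF Z'] L0_ind_def by (rule rv_class_cong)
      then show ?thesis using Z' D assms(6) by (auto simp: S1_def)
    qed
    have X'_S1: "X' \<in> S1 M S" and Y'_S1: "Y' \<in> S1 M S"
    proof -
      have "AE \<omega> in M. \<omega> \<in> rep D \<longrightarrow> nrm X \<omega> = 1" "AE \<omega> in M. \<omega> \<in> rep D \<longrightarrow> nrm Y \<omega> = 1"
        using props by (eventually_elim, simp)+
      then show "X' \<in> S1 M S" "Y' \<in> S1 M S" unfolding X'_def Y'_def using XY in_S1 by simp_all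
    qed
    have diff: "X' \<ominus>\<^bsub>S\<^esub> Y' = patch (rep D) (X \<ominus>\<^bsub>S\<^esub> Y) (\<zero>\<^bsub>S\<^esub> \<ominus>\<^bsub>S\<^esub> \<zero>\<^bsub>S\<^esub>)"
      and sum: "X' \<oplus>\<^bsub>S\<^esub> Y' = patch (rep D) (X \<oplus>\<^bsub>S\<^esub> Y) (\<zero>\<^bsub>S\<^esub> \<oplus>\<^bsub>S\<^esub> \<zero>\<^bsub>S\<^esub>)"
      unfolding X'_def Y'_def using XY by (simp_all add: patch_minus patch_plus)
    have on_D: "AE \<omega> in M. \<omega> \<in> rep D \<longrightarrow> nrm (patch (rep D) a b) \<omega> = nrm a \<omega>"
      if "a \<in> carrier S" "b \<in> carrier S" for a b
      using nrm_patch[OF Dm that] by eventually_elim auto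
    have "AE \<omega> in M. \<omega> \<in> rep D \<longrightarrow> nrm X' \<omega> = nrm X \<omega>" "AE \<omega> in M. \<omega> \<in> rep D \<longrightarrow> nrm Y' \<omega> = nrm Y \<omega>"
      "AE \<omega> in M. \<omega> \<in> rep D \<longrightarrow> nrm (X' \<ominus>\<^bsub>S\<^esub> Y') \<omega> = nrm (X \<ominus>\<^bsub>S\<^esub> Y) \<omega>"
      "AE \<omega> in M. \<omega> \<in> rep D \<longrightarrow> nrm (X' \<oplus>\<^bsub>S\<^esub> Y') \<omega> = nrm (X \<oplus>\<^bsub>S\<^esub> Y) \<omega>"
      unfolding diff sum unfolding X'_def Y'_def
      by (rule on_D; use XY in simp)+
    then have props': "AE \<omega> in M. \<omega> \<in> rep D \<longrightarrow> nrm X' \<omega> = 1 \<and> nrm Y' \<omega> = 1 \<and>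
        nrm (X' \<ominus>\<^bsub>S\<^esub> Y') \<omega> = rep \<epsilon> \<omega> \<and> nrm (x \<oplus>\<^bsub>S\<^esub> y) \<omega> \<le> nrm (X' \<oplus>\<^bsub>S\<^esub> Y') \<omega>"
      using props by eventually_elim auto
    have "?B X' Y'"
      unfolding ev_subset_def using rep_B_of[OF XY'] props' \<epsilon>_range by eventually_elim auto
    moreover have "?at X' Y'"
    proof (rule modulus_constraints(2)[OF D \<epsilon> XY'])
      show "AE \<omega> in M. \<omega> \<in> rep D \<longrightarrow> nrm (X' \<ominus>\<^bsub>S\<^esub> Y') \<omega> = rep \<epsilon> \<omega>"
        using props' by eventually_elim simp
    qed
    ultimately have "convexity_gap M S D X' Y' \<in> T1" unfolding T1_def using X'_S1 Y'_S1 by blast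
    moreover have gap_meas: "(\<lambda>\<omega>. ereal (indicator (rep D) \<omega> * (1 - nrm (a \<oplus>\<^bsub>S\<^esub> b) \<omega> / 2))) \<in> borel_measurable M"
      if "a \<in> carrier S" "b \<in> carrier S" for a b
    proof -
      have [measurable]: "nrm (a \<oplus>\<^bsub>S\<^esub> b) \<in> borel_measurable M" using that by auto
      show ?thesis by measurable
    qed
    have "convexity_gap M S D X' Y' \<in> RV M"
      unfolding convexity_gap_eq[OF D XY'] RV_def using gap_meas[OF XY'] by blast
    moreover have "rv_le M (convexity_gap M S D X' Y') g"
      unfolding g_eq convexity_gap_eq[OF D XY'] convexity_gap_eq[OF D xy]
        rv_le_class_iff[OF gap_meas[OF XY'] gap_meas[OF xy]]
      using props' by eventually_elim (auto simp: indicator_def)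
    ultimately show ?thesis by blast
  qed
  have "Lower (L0bar M) T1 \<subseteq> Lower (L0bar M) T2"
  proof
    fix z assume z: "z \<in> Lower (L0bar M) T1"
    have "rv_le M z g" if "g \<in> T2" for g
    proof -
      obtain h where h: "h \<in> T1" "h \<in> RV M" "rv_le M h g" using dominated[OF \<open>g \<in> T2\<close>] by blast
      then have "rv_le M z h" using z by (auto simp: Lower_def L0bar_def)
      then show ?thesis using h(3) unfolding rv_le_def by eventually_elim (rule order_trans)
    qed
    then show "z \<in> Lower (L0bar M) T2" using z by (auto simp: Lower_def L0bar_def)
  qed
  moreover have "Lower (L0bar M) T2 \<subseteq> Lower (L0bar M) T" "Lower (L0bar M) T \<subseteq> Lower (L0bar M) T1"
    by (intro Lower_antimono \<open>T1 \<subseteq> T\<close> \<open>T \<subseteq> T2\<close>)+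
  ultimately have "Lower (L0bar M) T = Lower (L0bar M) T1" "Lower (L0bar M) T1 = Lower (L0bar M) T2"
    by (metis subset_antisym subset_trans)+
  then show ?thesis
    unfolding delta_def delta1_def delta2_def T_def[symmetric] T1_def[symmetric] T2_def[symmetric] inf_def
    by simp
qed

end
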